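(* A Banach space $X$ is uniformly micro-semitransitive if and only if its dual $X^*$ is uniformly micro-semitransitive. Likewise, a Banach space $X$ is micro-transitive if and only if its dual $X^*$ is micro-transitive.
   Context: Banach spaces are over $\mathbb{K}=\mathbb{R}$ or $\mathbb{C}$. $S_X$ is the unit sphere of $X$, $\mathcal{L}(X)$ the space of bounded linear operators on $X$ with the operator norm, and $\mathrm{Id}$ the identity operator. A Banach space $X$ (or its norm) is micro-transitive if the group $G$ of surjective linear isometries of $X$ (with the operator-norm topology) acts micro-transitively on $S_X$: for every $x\in S_X$ and every neighborhood $U$ of $\mathrm{Id}$ in $G$, the set $Ux=\{Tx : T\in U\}$ is a neighborhood of $x$ in $S_X$. A Banach space $X$ (or its norm) is uniformly micro-semitransitive if there is a function $\beta:(0,2)\to(0,\infty)$ such that whenever $\varepsilon\in(0,2)$ and $x,y\in S_X$ satisfy $\|x-y\|<\beta(\varepsilon)$, there is $T\in\mathcal{L}(X)$ with $\|T\|=1$, $Tx=y$ and $\|T-\mathrm{Id}\|<\varepsilon$. *)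

theory Defs
  imports "HOL-Analysis.Analysis"
begin

section \<open>Complex Banach spaces\<close>

text \<open>A complex normed space is a real normed space with a complex scalar multiplication that
  extends the real one and with respect to which the norm is absolutely homogeneous.\<close>

class complex_normed_vector = real_normed_vector +
  fixes scaleC :: "complex \<Rightarrow> 'a \<Rightarrow> 'a"  (infixr \<open>*\<^sub>C\<close> 75)
  assumes scaleC_add_right: "c *\<^sub>C (x + y) = c *\<^sub>C x + c *\<^sub>C y"
    and scaleC_add_left: "(c + d) *\<^sub>C x = c *\<^sub>C x + d *\<^sub>C x"
    and scaleC_scaleC: "c *\<^sub>C (d *\<^sub>C x) = (c * d) *\<^sub>C x"
    and scaleC_one: "1 *\<^sub>C x = x"
    and scaleC_of_real: "of_real r *\<^sub>C x = r *\<^sub>R x"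
    and norm_scaleC: "norm (c *\<^sub>C x) = cmod c * norm x"

class complex_banach = complex_normed_vector + complete_space

subclass (in complex_banach) banach ..

lemma vector_space_scaleC: "vector_space (scaleC :: complex \<Rightarrow> 'a \<Rightarrow> 'a::complex_normed_vector)"
  by standard (simp_all add: scaleC_add_right scaleC_add_left scaleC_scaleC scaleC_one)

lemma vector_space_complex_mult: "vector_space ((*) :: complex \<Rightarrow> complex \<Rightarrow> complex)"
  by standard (simp_all add: algebra_simps)

lemma linear_scaleC_mult_iff:
  "Vector_Spaces.linear scaleC (*) (blinfun_apply f) \<longleftrightarrow> (\<forall>c x. blinfun_apply f (c *\<^sub>C x) = c * blinfun_apply f x)"
  for f :: "'a::complex_normed_vector \<Rightarrow>\<^sub>L complex"
  by (auto simp: Vector_Spaces.linear_def vector_space_scaleC vector_space_complex_mult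
      module_hom_def module_hom_axioms_def module_iff_vector_space blinfun.add_right)


section \<open>The complex dual\<close>

text \<open>The dual of a real space \<open>'a\<close> is the type of bounded linear maps from \<open>'a\<close> to \<open>real\<close> of
  \<open>HOL-Analysis\<close>. The dual of a complex space is the subspace of complex-linear maps in the type
  of bounded real-linear maps into \<open>complex\<close>, with the inherited operator norm.\<close>

typedef (overloaded) 'a cdual =
  "{f :: 'a::complex_normed_vector \<Rightarrow>\<^sub>L complex. Vector_Spaces.linear scaleC (*) (blinfun_apply f)}"
  morphisms blinfun_of_cdual Abs_cdual
  by (rule exI[of _ 0]) (simp add: linear_scaleC_mult_iff)

setup_lifting type_definition_cdual

instantiation cdual :: (complex_normed_vector) complex_normed_vector
begin

lift_definition norm_cdual :: "'a cdual \<Rightarrow> real" is norm .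

lift_definition zero_cdual :: "'a cdual" is 0
  by (simp add: linear_scaleC_mult_iff)

lift_definition plus_cdual :: "'a cdual \<Rightarrow> 'a cdual \<Rightarrow> 'a cdual" is "(+)"
  by (simp add: linear_scaleC_mult_iff blinfun.add_left algebra_simps)

lift_definition minus_cdual :: "'a cdual \<Rightarrow> 'a cdual \<Rightarrow> 'a cdual" is "(-)"
  by (simp add: linear_scaleC_mult_iff blinfun.diff_left algebra_simps)

lift_definition uminus_cdual :: "'a cdual \<Rightarrow> 'a cdual" is uminus
  by (simp add: linear_scaleC_mult_iff blinfun.minus_left)

lift_definition scaleR_cdual :: "real \<Rightarrow> 'a cdual \<Rightarrow> 'a cdual" is scaleR
  by (simp add: linear_scaleC_mult_iff blinfun.scaleR_left)

lift_definition scaleC_cdual :: "complex \<Rightarrow> 'a cdual \<Rightarrow> 'a cdual"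
  is "\<lambda>c f. blinfun_compose (Blinfun ((*) c)) f"
  by (simp add: linear_scaleC_mult_iff bounded_linear_Blinfun_apply bounded_linear_mult_right)

definition dist_cdual :: "'a cdual \<Rightarrow> 'a cdual \<Rightarrow> real"
  where "dist_cdual f g = norm (f - g)"

definition sgn_cdual :: "'a cdual \<Rightarrow> 'a cdual"
  where "sgn_cdual f = scaleR (inverse (norm f)) f"

definition uniformity_cdual :: "('a cdual \<times> 'a cdual) filter"
  where "uniformity_cdual = (INF e\<in>{0 <..}. principal {(x, y). dist x y < e})"

definition open_cdual :: "'a cdual set \<Rightarrow> bool"
  where "open_cdual S = (\<forall>x\<in>S. \<forall>\<^sub>F (x', y) in uniformity. x' = x \<longrightarrow> y \<in> S)"

instance
proof
  have mult: "blinfun_apply (Blinfun ((*) c)) = (*) c" for c :: complex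
    by (simp add: bounded_linear_Blinfun_apply bounded_linear_mult_right)
  fix f g h :: "'a cdual" and r s :: real and c d :: complex
  show "f + g + h = f + (g + h)" "f + g = g + f" "0 + f = f" "- f + f = 0" "f - g = f + - g"
    "r *\<^sub>R (f + g) = r *\<^sub>R f + r *\<^sub>R g" "(r + s) *\<^sub>R f = r *\<^sub>R f + s *\<^sub>R f"
    "r *\<^sub>R s *\<^sub>R f = (r * s) *\<^sub>R f" "1 *\<^sub>R f = f"
    by (transfer; simp add: algebra_simps)+
  show "sgn f = inverse (norm f) *\<^sub>R f" "dist f g = norm (f - g)"
    by (simp_all add: sgn_cdual_def dist_cdual_def)
  show "(uniformity :: ('a cdual \<times> 'a cdual) filter) = (INF e\<in>{0 <..}. principal {(x, y). dist x y < e})"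
    by (rule uniformity_cdual_def)
  show "open U = (\<forall>x\<in>U. \<forall>\<^sub>F (x', y) in uniformity. x' = x \<longrightarrow> y \<in> U)" for U :: "'a cdual set"
    by (rule open_cdual_def)
  show "norm f = 0 \<longleftrightarrow> f = 0" "norm (f + g) \<le> norm f + norm g" "norm (r *\<^sub>R f) = \<bar>r\<bar> * norm f"
    by (transfer; simp add: norm_triangle_ineq)+
  show "c *\<^sub>C (f + g) = c *\<^sub>C f + c *\<^sub>C g" "(c + d) *\<^sub>C f = c *\<^sub>C f + d *\<^sub>C f"
    "c *\<^sub>C d *\<^sub>C f = (c * d) *\<^sub>C f" "1 *\<^sub>C f = f" "of_real r *\<^sub>C f = r *\<^sub>R f"
    by (transfer; rule blinfun_eqI;
        simp add: mult blinfun.add_left blinfun.scaleR_left algebra_simps scaleR_conv_of_real)+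
  show "norm (c *\<^sub>C f) = cmod c * norm f"
  proof transfer
    fix c :: complex and f :: "'a \<Rightarrow>\<^sub>L complex"
    show "norm (Blinfun ((*) c) o\<^sub>L f) = cmod c * norm f"
    proof (cases "c = 0")
      case True
      then have "Blinfun ((*) c) o\<^sub>L f = 0"
        by (intro blinfun_eqI) (simp add: mult)
      then show ?thesis using True by simp
    next
      case False
      have "norm (Blinfun ((*) c) o\<^sub>L f) \<le> cmod c * norm f"
        by (intro norm_blinfun_bound)
          (simp_all add: mult norm_mult mult_left_mono norm_blinfun mult.assoc)
      moreover have "norm f \<le> norm (Blinfun ((*) c) o\<^sub>L f) / cmod c"
      proof (rule norm_blinfun_bound)
        fix x
        have "cmod c * norm (f x) \<le> norm (Blinfun ((*) c) o\<^sub>L f) * norm x"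
          using norm_blinfun[of "Blinfun ((*) c) o\<^sub>L f" x] by (simp add: mult norm_mult)
        then show "norm (f x) \<le> norm (Blinfun ((*) c) o\<^sub>L f) / cmod c * norm x"
          using False by (simp add: field_simps)
      qed simp
      ultimately show ?thesis using False by (simp add: field_simps)
    qed
  qed
qed

end

instance cdual :: (complex_normed_vector) complex_banach
proof
  fix X :: "nat \<Rightarrow> 'a cdual"
  assume "Cauchy X"
  have dist: "dist (blinfun_of_cdual f) (blinfun_of_cdual g) = dist f g" for f g :: "'a cdual"
    by (simp add: dist_norm norm_cdual.rep_eq minus_cdual.rep_eq)
  from \<open>Cauchy X\<close> have "Cauchy (\<lambda>n. blinfun_of_cdual (X n))"
    by (simp add: Cauchy_def dist)
  then obtain L where L: "(\<lambda>n. blinfun_of_cdual (X n)) \<longlonglongrightarrow> L"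
    using Cauchy_convergent convergent_def by blast
  have "blinfun_apply L (c *\<^sub>C x) = c * blinfun_apply L x" for c x
  proof (rule LIMSEQ_unique)
    show "(\<lambda>n. blinfun_of_cdual (X n) (c *\<^sub>C x)) \<longlonglongrightarrow> L (c *\<^sub>C x)"
      by (intro tendsto_intros L)
    have "(\<lambda>n. c * blinfun_of_cdual (X n) x) \<longlonglongrightarrow> c * L x"
      by (intro tendsto_intros L)
    moreover have "blinfun_of_cdual (X n) (c *\<^sub>C x) = c * blinfun_of_cdual (X n) x" for n
      using blinfun_of_cdual[of "X n"] by (simp add: linear_scaleC_mult_iff)
    ultimately show "(\<lambda>n. blinfun_of_cdual (X n) (c *\<^sub>C x)) \<longlonglongrightarrow> c * L x"
      by simp
  qed
  then have "blinfun_of_cdual (Abs_cdual L) = L"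
    by (intro Abs_cdual_inverse) (simp add: linear_scaleC_mult_iff)
  then have "X \<longlonglongrightarrow> Abs_cdual L"
    using L by (simp add: tendsto_iff dist[symmetric])
  then show "convergent X"
    by (auto simp: convergent_def)
qed


section \<open>Micro-transitivity\<close>

text \<open>In the following definitions \<open>s\<close> is the scalar multiplication of the space \<open>'a\<close>, which
  determines the scalar field. It is instantiated with \<^const>\<open>scaleR\<close> or \<^const>\<open>scaleC\<close>.\<close>

definition bounded_operators :: "('k::field \<Rightarrow> 'a \<Rightarrow> 'a) \<Rightarrow> ('a::real_normed_vector \<Rightarrow>\<^sub>L 'a) set" where
  "bounded_operators s = {T. Vector_Spaces.linear s s (blinfun_apply T)}"

definition surjective_isometries :: "('k::field \<Rightarrow> 'a \<Rightarrow> 'a) \<Rightarrow> ('a::real_normed_vector \<Rightarrow>\<^sub>L 'a) set" where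
  "surjective_isometries s =
    {T \<in> bounded_operators s. surj (blinfun_apply T) \<and> (\<forall>x. norm (blinfun_apply T x) = norm x)}"

definition neighbourhood_in :: "'a topology \<Rightarrow> 'a \<Rightarrow> 'a set \<Rightarrow> bool" where
  "neighbourhood_in X x U \<longleftrightarrow> U \<subseteq> topspace X \<and> (\<exists>W. openin X W \<and> x \<in> W \<and> W \<subseteq> U)"

definition micro_transitive :: "('k::field \<Rightarrow> 'a \<Rightarrow> 'a::real_normed_vector) \<Rightarrow> bool" where
  "micro_transitive s \<longleftrightarrow>
    (\<forall>x \<in> sphere 0 1. \<forall>U. neighbourhood_in (top_of_set (surjective_isometries s)) id_blinfun U \<longrightarrow>
      neighbourhood_in (top_of_set (sphere 0 1)) x ((\<lambda>T. blinfun_apply T x) ` U))"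

definition uniformly_micro_semitransitive :: "('k::field \<Rightarrow> 'a \<Rightarrow> 'a::real_normed_vector) \<Rightarrow> bool" where
  "uniformly_micro_semitransitive s \<longleftrightarrow>
    (\<exists>\<beta> :: real \<Rightarrow> real. (\<forall>\<epsilon> \<in> {0<..<2}. \<beta> \<epsilon> > 0) \<and>
      (\<forall>\<epsilon> \<in> {0<..<2}. \<forall>x \<in> sphere 0 1. \<forall>y \<in> sphere 0 1. norm (x - y) < \<beta> \<epsilon> \<longrightarrow>
        (\<exists>T \<in> bounded_operators s.
          norm T = 1 \<and> blinfun_apply T x = y \<and> norm (T - id_blinfun) < \<epsilon>)))"

end

theory Submission
  imports Defs
begin

text \<open>Only the underlying real spaces matter until the very end, since complex-linear contractions are
  in particular real-linear. If contractions near the identity move points of the sphere to all nearby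
  points, then the norm is uniformly smooth: for \<open>a = x + \<tau>z\<close> and \<open>b = x - \<tau>z\<close>, moving \<open>a/\<parallel>a\<parallel>\<close> to
  \<open>b/\<parallel>b\<parallel>\<close> by \<open>T\<close> and evaluating a functional norming \<open>b\<close> gives
  \<open>\<parallel>a\<parallel> + \<parallel>b\<parallel> - 2 \<le> \<tau>\<parallel>T - Id\<parallel>\<close>. Hence the space is reflexive. If it were not uniformly convex, then,
  as every point of the sphere can be moved to every other one by a contraction that is bounded below
  by a fixed constant, every point of the sphere would nearly be the midpoint of two unit vectors at a
  fixed distance. This contradicts the existence of small slices of separable bounded sets in reflexive
  spaces, a consequence of Baire's theorem in the dual. So the space is reflexive, uniformly smooth and
  uniformly convex, points of either sphere have close norming partners in the other one exactly when
  they are close themselves, and the adjoint of an operator moving one norming partner to another moves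
  the functionals backwards.\<close>

section \<open>Sublinear functionals\<close>

text \<open>Two equivalences over two scalar fields reduce to one argument about a real-valued
  pairing \<open>p\<close> and a set \<open>G\<close> of contractions: all scalar-linear
  contractions for semitransitivity, surjective isometries for micro-transitivity. Exchanging the
  arguments of \<open>p\<close> turns one direction into the other, but it yields a dual pair only
  for a reflexive left space. When the hypothesis is on the dual, reflexivity of the space is
  reached through uniform convexity of the dual, which makes the space uniformly smooth. Convexity
  supplies what smoothness alone does not: smoothness makes the norming functionals of close points
  close, while the adjoint argument needs close functionals to be normed at close points.
  Separation, norming functionals and the attainment of suprema in reflexive spaces are all drawn
  from the Mazur-Orlicz theorem, applied to the norm, to a perturbed norm or to a support
  function.\<close>

definition sublinear :: "('a::real_vector \<Rightarrow> real) \<Rightarrow> bool" where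
  "sublinear p \<longleftrightarrow> (\<forall>x y. p (x + y) \<le> p x + p y) \<and> (\<forall>t\<ge>0. \<forall>x. p (t *\<^sub>R x) = t * p x)"

lemma sublinear_add: "sublinear p \<Longrightarrow> p (x + y) \<le> p x + p y"
  and sublinear_scale: "sublinear p \<Longrightarrow> t \<ge> 0 \<Longrightarrow> p (t *\<^sub>R x) = t * p x"
  by (auto simp: sublinear_def)

lemma sublinear_zero: "sublinear p \<Longrightarrow> p 0 = 0"
  using sublinear_scale[of p 0 0] by simp

lemma sublinear_minus: "sublinear p \<Longrightarrow> - p (- x) \<le> p x"
  using sublinear_add[of p x "- x"] sublinear_zero[of p] by simp

text \<open>The inequality \<open>scale\<close> at \<open>inverse t\<close> supplies the missing
  half of homogeneity.\<close>

lemma sublinearI: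
  assumes add: "\<And>x y. p (x + y) \<le> p x + p y"
    and scale: "\<And>t x. t > 0 \<Longrightarrow> p (t *\<^sub>R x) \<le> t * p x" and zero: "p 0 = 0"
  shows "sublinear p"
  unfolding sublinear_def
proof (intro conjI allI impI add)
  fix t :: real and x assume "t \<ge> 0"
  show "p (t *\<^sub>R x) = t * p x"
  proof (cases "t = 0")
    case False
    with \<open>t \<ge> 0\<close> have "t > 0" by simp
    have "p x \<le> inverse t * p (t *\<^sub>R x)"
      using scale[of "inverse t" "t *\<^sub>R x"] \<open>t > 0\<close> by simp
    then have "t * p x \<le> p (t *\<^sub>R x)"
      using \<open>t > 0\<close> by (simp add: field_simps)
    with scale[OF \<open>t > 0\<close>, of x] show ?thesis by simp
  qed (simp add: zero)
qed

text \<open>The infimum of \<open>p (z + t *\<^sub>R a) - t * d\<close> over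
  \<open>t \<ge> 0\<close> and \<open>a\<close> in \<open>A\<close> is the largest sublinear
  functional below \<open>p\<close> that is at most \<open>- d\<close> on \<open>- A\<close>.
  Singletons \<open>A\<close> serve the linearity of minimal functionals, general ones the
  Mazur-Orlicz theorem.\<close>

lemma sublinear_shift:
  assumes p: "sublinear p" and A: "convex A" "A \<noteq> {}" and d: "\<And>a. a \<in> A \<Longrightarrow> d \<le> p a"
  obtains q where "sublinear q" "q \<le> p" "\<And>a. a \<in> A \<Longrightarrow> q (- a) \<le> - d"
proof
  define g where "g z = (\<lambda>(t, a). p (z + t *\<^sub>R a) - t * d)" for z
  define I where "I = {0::real..} \<times> A"
  define q where "q z = Inf (g z ` I)" for z
  have ne: "g z ` I \<noteq> {}" for z using A by (auto simp: I_def)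
  \<comment> \<open>This bound keeps the infimum finite; here the lower bound \<open>d\<close> of
    \<open>p\<close> on \<open>A\<close> enters.\<close>
  have lower: "- p (- z) \<le> p (z + t *\<^sub>R a) - t * d" if "t \<ge> 0" "a \<in> A" for z t a
  proof -
    have "t * d \<le> p (t *\<^sub>R a)" using that d[of a] p by (simp add: sublinear_scale mult_left_mono)
    also have "\<dots> \<le> p (z + t *\<^sub>R a) + p (- z)" using sublinear_add[OF p, of "z + t *\<^sub>R a" "- z"] by simp
    finally show ?thesis by simp
  qed
  have bdd: "bdd_below (g z ` I)" for z
    by (rule bdd_belowI[of _ "- p (- z)"]) (auto simp: g_def I_def intro: lower)
  have le: "q z \<le> p (z + t *\<^sub>R a) - t * d" if "t \<ge> 0" "a \<in> A" for z t a
    unfolding q_def by (rule cInf_lower2[OF _ _ bdd, of "g z (t, a)"]) (use that in \<open>auto simp: I_def g_def\<close>)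
  have ge: "c \<le> q z" if "\<And>t a. t \<ge> 0 \<Longrightarrow> a \<in> A \<Longrightarrow> c \<le> p (z + t *\<^sub>R a) - t * d" for c z
    unfolding q_def by (rule cInf_greatest[OF ne]) (use that in \<open>auto simp: I_def g_def\<close>)
  obtain a0 where a0: "a0 \<in> A" using A by auto
  show "q \<le> p" using le[OF order_refl a0] by (auto simp: le_fun_def)
  show "q (- a) \<le> - d" if "a \<in> A" for a
    using le[of 1 a "- a"] that sublinear_zero[OF p] by simp
  show "sublinear q"
  proof (rule sublinearI)
    show "q 0 = 0"
    proof (rule antisym)
      show "q 0 \<le> 0" using le[OF order_refl a0, of 0] sublinear_zero[OF p] by simp
      show "0 \<le> q 0" using lower[of _ _ 0] sublinear_zero[OF p] by (intro ge) simp
    qed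
    show "q (s *\<^sub>R x) \<le> s * q x" if "s > 0" for s x
    proof -
      have "q (s *\<^sub>R x) / s \<le> q x"
      proof (rule ge)
        fix t :: real and a assume "t \<ge> 0" "a \<in> A"
        then have "q (s *\<^sub>R x) \<le> p (s *\<^sub>R x + (s * t) *\<^sub>R a) - (s * t) * d"
          using that by (intro le) auto
        also have "s *\<^sub>R x + (s * t) *\<^sub>R a = s *\<^sub>R (x + t *\<^sub>R a)" by (simp add: algebra_simps)
        also have "p \<dots> - (s * t) * d = s * (p (x + t *\<^sub>R a) - t * d)"
          using that sublinear_scale[OF p, of s "x + t *\<^sub>R a"] by (simp add: right_diff_distrib)
        finally show "q (s *\<^sub>R x) / s \<le> p (x + t *\<^sub>R a) - t * d"
          using that by (simp add: field_simps)
      qed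
      then show ?thesis using that by (simp add: field_simps)
    qed
    show "q (x + y) \<le> q x + q y" for x y
    proof -
      have *: "q (x + y) \<le> (p (x + t *\<^sub>R a) - t * d) + (p (y + s *\<^sub>R b) - s * d)"
        if "t \<ge> 0" "a \<in> A" "s \<ge> 0" "b \<in> A" for t a s b
      proof -
        \<comment> \<open>Convexity of \<open>A\<close>: two translations in directions from
          \<open>A\<close> merge into one, which makes the infimum subadditive.\<close>
        have "\<exists>c\<in>A. (t + s) *\<^sub>R c = t *\<^sub>R a + s *\<^sub>R b"
        proof (cases "t + s = 0")
          case True
          then have "t = 0" "s = 0" using that by auto
          then show ?thesis using \<open>a \<in> A\<close> by auto
        next
          case False
          then have "t + s > 0" using that by simp
          show ?thesis
          proof (rule bexI)
            show "(t / (t + s)) *\<^sub>R a + (s / (t + s)) *\<^sub>R b \<in> A"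
              using that \<open>t + s > 0\<close> by (intro convexD[OF A(1)]) (simp_all add: add_divide_distrib[symmetric])
            show "(t + s) *\<^sub>R ((t / (t + s)) *\<^sub>R a + (s / (t + s)) *\<^sub>R b) = t *\<^sub>R a + s *\<^sub>R b"
              using False by (simp add: scaleR_add_right)
          qed
        qed
        then obtain c where c: "c \<in> A" "(t + s) *\<^sub>R c = t *\<^sub>R a + s *\<^sub>R b" by blast
        have "q (x + y) \<le> p ((x + y) + (t + s) *\<^sub>R c) - (t + s) * d"
          using that c by (intro le) auto
        also have "(x + y) + (t + s) *\<^sub>R c = (x + t *\<^sub>R a) + (y + s *\<^sub>R b)"
          unfolding c(2) by (simp add: ac_simps)
        also have "p \<dots> - (t + s) * d \<le> (p (x + t *\<^sub>R a) - t * d) + (p (y + s *\<^sub>R b) - s * d)"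
          using sublinear_add[OF p, of "x + t *\<^sub>R a" "y + s *\<^sub>R b"] by (simp add: algebra_simps)
        finally show ?thesis .
      qed
      have "q (x + y) - q y \<le> q x"
      proof (rule ge)
        fix t :: real and a assume ta: "t \<ge> 0" "a \<in> A"
        have "q (x + y) - (p (x + t *\<^sub>R a) - t * d) \<le> q y"
          by (rule ge) (simp add: diff_le_eq add.commute[of _ "p (x + t *\<^sub>R a) - t * d"] *[OF ta])
        then show "q (x + y) - q y \<le> p (x + t *\<^sub>R a) - t * d" by simp
      qed
      then show ?thesis by simp
    qed
  qed
qed

text \<open>Minimality against the functional shifted along \<open>{y}\<close> forces
  \<open>p (- y) \<le> - p y\<close>; an odd sublinear functional is linear.\<close>

lemma minimal_sublinear_linear:
  assumes p: "sublinear p" and min: "\<And>q. sublinear q \<Longrightarrow> q \<le> p \<Longrightarrow> q = p"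
  shows "linear p"
proof -
  have neg: "p (- y) = - p y" for y
  proof -
    obtain q where q: "sublinear q" "q \<le> p" "q (- y) \<le> - p y"
      by (rule sublinear_shift[OF p, of "{y}" "p y"]) auto
    with min[OF q(1,2)] sublinear_minus[OF p, of y] show ?thesis by simp
  qed
  show ?thesis
  proof (rule linearI)
    show "p (x + y) = p x + p y" for x y
      using sublinear_add[OF p, of x y] sublinear_add[OF p, of "- x" "- y"] neg[of "x + y"] neg[of x] neg[of y]
      by simp
    show "p (t *\<^sub>R x) = t *\<^sub>R p x" for t x
    proof (cases "t \<ge> 0")
      case False
      then have "p ((- t) *\<^sub>R (- x)) = (- t) * p (- x)" by (intro sublinear_scale[OF p]) auto
      then show ?thesis by (simp add: neg)
    qed (simp add: sublinear_scale[OF p])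
  qed
qed

text \<open>Hahn-Banach without extension from subspaces: Zorn's lemma yields a minimal sublinear
  functional below \<open>p\<close>, with pointwise infima as bounds of chains.\<close>

lemma linear_below_sublinear:
  assumes p: "sublinear p"
  obtains f where "linear f" "f \<le> p"
proof -
  define A where "A = {q. sublinear q \<and> q \<le> p}"
  \<comment> \<open>The order is reversed, because \<open>predicate_Zorn\<close> delivers maximal
    elements.\<close>
  define P where "P q r \<longleftrightarrow> r \<le> q" for q r :: "'a \<Rightarrow> real"
  have po: "partial_order_on A (relation_of P A)"
    by (rule partial_order_on_relation_ofI) (auto simp: P_def)
  have "\<exists>u\<in>A. \<forall>a\<in>C. P a u" if C: "C \<in> Chains (relation_of P A)" for C
  proof (cases "C = {}")
    case True then show ?thesis using p by (auto simp: A_def)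
  next
    case False
    have CA: "C \<subseteq> A" and tot: "\<And>q r. q \<in> C \<Longrightarrow> r \<in> C \<Longrightarrow> q \<le> r \<or> r \<le> q"
      using C by (auto simp: Chains_def relation_of_def P_def)
    \<comment> \<open>A lower bound common to the whole chain, since every member lies below
      \<open>p\<close>.\<close>
    have lower: "- p (- x) \<le> q x" if "q \<in> C" for q x
    proof -
      have "sublinear q" "q (- x) \<le> p (- x)" using that CA by (auto simp: A_def le_fun_def)
      then show ?thesis using sublinear_minus[of q x] by simp
    qed
    define u where "u x = (INF q\<in>C. q x)" for x
    have le: "u x \<le> q x" if "q \<in> C" for q x
      unfolding u_def by (rule cINF_lower[OF bdd_belowI2 that]) (rule lower)
    have ge: "c \<le> u x" if "\<And>q. q \<in> C \<Longrightarrow> c \<le> q x" for c x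
      unfolding u_def by (rule cINF_greatest[OF False that])
    have "sublinear u"
    proof (rule sublinearI)
      obtain q where "q \<in> C" using False by auto
      have zero: "r 0 = 0" if "r \<in> C" for r using that CA by (auto simp: A_def sublinear_zero)
      show "u 0 = 0"
        using le[OF \<open>q \<in> C\<close>, of 0] ge[of 0 0] zero[OF \<open>q \<in> C\<close>] zero by force
      show "u (t *\<^sub>R x) \<le> t * u x" if "t > 0" for t x
      proof -
        have "u (t *\<^sub>R x) / t \<le> u x"
        proof (rule ge)
          fix q assume "q \<in> C"
          with le[of q "t *\<^sub>R x"] CA that show "u (t *\<^sub>R x) / t \<le> q x"
            by (auto simp: A_def sublinear_scale field_simps)
        qed
        then show ?thesis using that by (simp add: field_simps)
      qed
      show "u (x + y) \<le> u x + u y" for x y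
      proof -
        have *: "u (x + y) \<le> q x + r y" if qr: "q \<in> C" "r \<in> C" for q r
        proof -
          \<comment> \<open>Totality of the chain: one of \<open>q\<close> and \<open>r\<close> lies
            below both.\<close>
          obtain s where s: "s \<in> C" "s \<le> q" "s \<le> r"
            using tot[OF qr] qr by (elim disjE) (auto intro: that[of q] that[of r])
          have "u (x + y) \<le> s x + s y"
            using le[OF s(1), of "x + y"] CA s(1) sublinear_add[of s x y] by (auto simp: A_def)
          also have "\<dots> \<le> q x + r y" using s by (auto simp: le_fun_def intro: add_mono)
          finally show ?thesis .
        qed
        have "u (x + y) - u y \<le> u x"
        proof (rule ge)
          fix q assume "q \<in> C"
          have "u (x + y) - q x \<le> u y"
            by (rule ge) (simp add: diff_le_eq add.commute[of _ "q x"] *[OF \<open>q \<in> C\<close>])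
          then show "u (x + y) - u y \<le> q x" by simp
        qed
        then show ?thesis by simp
      qed
    qed
    moreover have "u \<le> p"
    proof -
      obtain q where "q \<in> C" using False by auto
      then have "u \<le> q" "q \<le> p" using le CA by (auto simp: le_fun_def A_def)
      then show ?thesis by (rule order_trans)
    qed
    ultimately show ?thesis using le by (auto simp: A_def P_def le_fun_def)
  qed
  then obtain m where m: "m \<in> A" "\<forall>a\<in>A. P m a \<longrightarrow> a = m"
    using predicate_Zorn[OF po] by blast
  have "linear m"
  proof (rule minimal_sublinear_linear)
    show "sublinear m" using m by (auto simp: A_def)
    show "q = m" if "sublinear q" "q \<le> m" for q
      using m that by (auto simp: A_def P_def)
  qed
  with m show ?thesis by (intro that) (auto simp: A_def)
qed

text \<open>After the shift any linear \<open>f\<close> below \<open>q\<close> does it: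
  \<open>- f a = f (- a) \<le> q (- a) \<le> - d\<close>.\<close>

theorem mazur_orlicz:
  assumes "sublinear p" "convex A" "A \<noteq> {}" "\<And>a. a \<in> A \<Longrightarrow> d \<le> p a"
  obtains f where "linear f" "f \<le> p" "\<And>a. a \<in> A \<Longrightarrow> d \<le> f a"
proof -
  obtain q where q: "sublinear q" "q \<le> p" "\<And>a. a \<in> A \<Longrightarrow> q (- a) \<le> - d"
    using sublinear_shift[OF assms] by metis
  obtain f where f: "linear f" "f \<le> q" using linear_below_sublinear[OF q(1)] by metis
  show ?thesis
  proof
    show "linear f" "f \<le> p" using f q(2) by (auto intro: order_trans)
    show "d \<le> f a" if "a \<in> A" for a
    proof -
      have "- f a = f (- a)" using f by (simp add: linear_neg)
      also have "\<dots> \<le> q (- a)" using f by (simp add: le_fun_def)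
      also have "\<dots> \<le> - d" using q(3) that .
      finally show ?thesis by simp
    qed
  qed
qed

section \<open>Bounded functionals: separation and norming\<close>

lemma sublinear_norm_multiple: "c \<ge> 0 \<Longrightarrow> sublinear (\<lambda>x. c * norm x)"
  using norm_triangle_ineq by (auto simp: sublinear_def distrib_left[symmetric] intro: mult_left_mono)

lemma blinfun_of_linear:
  fixes f :: "'a::real_normed_vector \<Rightarrow> real"
  assumes "linear f" and c: "c \<ge> 0" and le: "\<And>x. f x \<le> c * norm x"
  obtains F :: "'a \<Rightarrow>\<^sub>L real" where "blinfun_apply F = f" "norm F \<le> c"
proof -
  have abs: "norm (f x) \<le> c * norm x" for x
    using le[of x] le[of "- x"] \<open>linear f\<close> by (auto simp: linear_neg)
  have "bounded_linear f"
    using \<open>linear f\<close> abs by (intro bounded_linear.intro bounded_linear_axioms.intro) (auto simp: mult.commute intro: exI[of _ c])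
  then have F: "blinfun_apply (Blinfun f) = f" by (rule bounded_linear_Blinfun_apply)
  show ?thesis
    by (rule that[OF F]) (rule norm_blinfun_bound, use c abs F in auto)
qed

text \<open>Mazur-Orlicz for the norm on the convex set of all \<open>x - k\<close>, whose members
  have norm at least \<open>d\<close>.\<close>

theorem separating_functional:
  fixes x :: "'a::real_normed_vector"
  assumes "convex K" "K \<noteq> {}" "\<And>k. k \<in> K \<Longrightarrow> d \<le> norm (x - k)"
  obtains f :: "'a \<Rightarrow>\<^sub>L real" where "norm f \<le> 1" "\<And>k. k \<in> K \<Longrightarrow> f k + d \<le> f x"
proof -
  have "(\<lambda>k. x - k) ` K = (\<lambda>k. x + (-1) *\<^sub>R k) ` K" by simp
  also have "convex \<dots>" using assms(1) by (rule convex_affinity)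
  finally have "convex ((\<lambda>k. x - k) ` K)" .
  then obtain f where f: "linear f" "f \<le> (\<lambda>x. 1 * norm x)" "\<And>k. k \<in> K \<Longrightarrow> d \<le> f (x - k)"
    by (rule mazur_orlicz[OF sublinear_norm_multiple[OF zero_le_one], of _ d]) (use assms in auto)
  obtain F :: "'a \<Rightarrow>\<^sub>L real" where F: "blinfun_apply F = f" "norm F \<le> 1"
    by (rule blinfun_of_linear[OF f(1), of 1]) (use f(2) in \<open>auto simp: le_fun_def\<close>)
  show ?thesis
    by (rule that[OF F(2)]) (use f(3) in \<open>auto simp: F linear_diff[OF f(1)] algebra_simps\<close>)
qed

corollary norming_functional:
  fixes x :: "'a::real_normed_vector"
  obtains f :: "'a \<Rightarrow>\<^sub>L real" where "norm f \<le> 1" "f x = norm x"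
proof -
  obtain f :: "'a \<Rightarrow>\<^sub>L real" where f: "norm f \<le> 1" "norm x \<le> f x"
    using separating_functional[of "{0}" "norm x" x] by (auto simp: blinfun.zero_right)
  have "f x \<le> norm f * norm x" using norm_blinfun[of f x] by simp
  also have "\<dots> \<le> 1 * norm x" using f(1) by (rule mult_right_mono) simp
  finally show ?thesis using f that[of f] by simp
qed

section \<open>Uniform smoothness and reflexivity\<close>

lemma blinfun_le:
  fixes f :: "'a::real_normed_vector \<Rightarrow>\<^sub>L real"
  assumes "norm f \<le> c" "norm x \<le> d"
  shows "f x \<le> c * d"
proof -
  have "f x \<le> norm f * norm x" using norm_blinfun[of f x] by simp
  also have "\<dots> \<le> c * d" using assms norm_ge_zero[of f] norm_ge_zero[of x] by (intro mult_mono) linarith+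
  finally show ?thesis .
qed

text \<open>A one-sided bound suffices because the unit ball is symmetric.\<close>

lemma blinfun_norm_le:
  fixes f :: "'a::real_normed_vector \<Rightarrow>\<^sub>L real"
  assumes "c \<ge> 0" "\<And>x. norm x \<le> 1 \<Longrightarrow> f x \<le> c"
  shows "norm f \<le> c"
proof (rule norm_blinfun_bound[OF \<open>c \<ge> 0\<close>])
  fix x
  have "f (sgn x) \<le> c" "f (sgn (- x)) \<le> c"
    by (rule assms(2), simp add: norm_sgn)+
  then have *: "\<bar>f (sgn x)\<bar> \<le> c" by (simp add: sgn_minus blinfun.minus_right)
  have "norm (f x) = \<bar>f (sgn x)\<bar> * norm x"
    by (cases "x = 0") (simp_all add: sgn_div_norm blinfun.scaleR_right abs_mult field_simps)
  with * show "norm (f x) \<le> c * norm x" by (simp add: mult_right_mono)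
qed

lemma near_norming_vector:
  fixes f :: "'a::real_normed_vector \<Rightarrow>\<^sub>L real"
  assumes "0 \<le> c" "c < norm f"
  obtains x where "norm x \<le> 1" "c < f x"
  using blinfun_norm_le[OF assms(1), of f] assms(2) by (meson not_le)

lemma closed_separated_point:
  fixes S :: "'a::metric_space set"
  assumes "closed S" "a \<notin> S"
  obtains d where "d > 0" "\<And>x. x \<in> S \<Longrightarrow> d \<le> dist a x"
proof -
  obtain d where "d > 0" "ball a d \<subseteq> - S"
    using assms by (meson ComplI closed_def open_contains_ball)
  then show ?thesis by (intro that[of d]) (auto simp: subset_iff not_less[symmetric])
qed

text \<open>Equivalent, by duality, to the usual definition through the modulus of smoothness.\<close>

definition uniformly_smooth :: "'a::real_normed_vector itself \<Rightarrow> bool" where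
  "uniformly_smooth _ \<longleftrightarrow> (\<forall>\<epsilon>>0. \<exists>\<delta>>0. \<forall>(f :: 'a \<Rightarrow>\<^sub>L real) (g :: 'a \<Rightarrow>\<^sub>L real) x.
    norm f \<le> 1 \<longrightarrow> norm g \<le> 1 \<longrightarrow> norm x \<le> 1 \<longrightarrow>
    blinfun_apply f x > 1 - \<delta> \<longrightarrow> blinfun_apply g x > 1 - \<delta> \<longrightarrow> norm (f - g) \<le> \<epsilon>)"

definition reflexive_space :: "'a::real_normed_vector itself \<Rightarrow> bool" where
  "reflexive_space _ \<longleftrightarrow> (\<forall>F :: ('a \<Rightarrow>\<^sub>L real) \<Rightarrow>\<^sub>L real. \<exists>x. \<forall>f. F f = blinfun_apply f x)"

text \<open>Duality for the line spanned by evaluation at \<open>x\<close>: the norm of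
  \<open>F\<close> on the annihilator of \<open>x\<close> bounds the distance of \<open>F\<close>
  from that line. A linear \<open>L\<close> below \<open>c * norm f - F f\<close> that is
  nonnegative on the annihilator, a subspace, vanishes there and so is a multiple of evaluation at
  \<open>x\<close>.\<close>

lemma annihilator_functional:
  fixes F :: "('a::real_normed_vector \<Rightarrow>\<^sub>L real) \<Rightarrow>\<^sub>L real"
  assumes c: "c \<ge> 0" and le: "\<And>h. blinfun_apply h x = 0 \<Longrightarrow> F h \<le> c * norm h"
  obtains t where "\<And>f. F f - t * blinfun_apply f x \<le> c * norm f"
proof -
  define A where "A = {h :: 'a \<Rightarrow>\<^sub>L real. h x = 0}"
  have "convex A" by (auto simp: A_def convex_def blinfun.add_left blinfun.scaleR_left)
  have "sublinear (\<lambda>f. c * norm f - F f)"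
    using sublinear_norm_multiple[OF c, where 'a = "'a \<Rightarrow>\<^sub>L real"]
    by (simp add: sublinear_def blinfun.add_right blinfun.scaleR_right right_diff_distrib)
  then obtain L where L: "linear L" "L \<le> (\<lambda>f. c * norm f - F f)" "\<And>h. h \<in> A \<Longrightarrow> 0 \<le> L h"
  proof (rule mazur_orlicz[OF _ \<open>convex A\<close>])
    show "A \<noteq> {}" by (auto simp: A_def intro: exI[of _ 0])
    show "0 \<le> c * norm h - F h" if "h \<in> A" for h using le that by (simp add: A_def)
  qed blast
  have zero: "L h = 0" if "blinfun_apply h x = 0" for h
    using L(3)[of h] L(3)[of "- h"] that by (auto simp: A_def linear_neg[OF L(1)] blinfun.minus_left)
  \<comment> \<open>For \<open>x = 0\<close> the quotients by \<open>k x = 0\<close> are 0 by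
    convention, which fits since then \<open>L\<close> vanishes everywhere.\<close>
  obtain k :: "'a \<Rightarrow>\<^sub>L real" where k: "x \<noteq> 0 \<Longrightarrow> k x \<noteq> 0"
    using norming_functional[of x] by (metis norm_eq_zero)
  show ?thesis
  proof (rule that)
    fix f :: "'a \<Rightarrow>\<^sub>L real"
    have "L (f - (f x / k x) *\<^sub>R k) = 0"
    proof (rule zero)
      show "(f - (f x / k x) *\<^sub>R k) x = 0"
        using k by (cases "x = 0") (simp_all add: blinfun.diff_left blinfun.scaleR_left blinfun.zero_right)
    qed
    then have "L f = L k / k x * f x"
      by (simp add: linear_diff[OF L(1)] linear_cmul[OF L(1)])
    then show "F f - (- L k / k x) * f x \<le> c * norm f"
      using L(2) by (simp add: le_fun_def) (smt (verit, best))
  qed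
qed

section \<open>The bidual and reflexivity\<close>

definition canonical_embedding :: "'a::real_normed_vector \<Rightarrow> ('a \<Rightarrow>\<^sub>L real) \<Rightarrow>\<^sub>L real" where
  "canonical_embedding x = Blinfun (\<lambda>f. blinfun_apply f x)"

lemma canonical_embedding_apply [simp]: "canonical_embedding x f = f x"
  by (simp add: canonical_embedding_def bounded_linear_Blinfun_apply blinfun.bounded_linear_left)

lemma norm_canonical_embedding: "norm (canonical_embedding x) = norm (x :: 'a::real_normed_vector)"
proof (rule antisym)
  show "norm (canonical_embedding x) \<le> norm x"
    by (rule blinfun_norm_le) (use blinfun_le[of _ 1 x "norm x"] in auto)
  obtain f :: "'a \<Rightarrow>\<^sub>L real" where f: "norm f \<le> 1" "f x = norm x" by (rule norming_functional)
  then show "norm x \<le> norm (canonical_embedding x)"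
    using blinfun_le[of "canonical_embedding x" _ f 1, OF order_refl] by simp
qed

lemma bounded_linear_canonical_embedding: "bounded_linear canonical_embedding"
  by (rule bounded_linear_intro[of _ 1])
    (auto intro!: blinfun_eqI simp: blinfun.add_right blinfun.scaleR_right blinfun.add_left blinfun.scaleR_left
      norm_canonical_embedding)

text \<open>Riesz's lemma for the range of the embedding, closed because it is an isometric image of
  a complete space: subtract an almost nearest point from some \<open>G\<close> outside and
  normalise.\<close>

lemma far_from_canonical_embedding:
  assumes "\<not> reflexive_space TYPE('a::banach)" and \<theta>: "0 < \<theta>" "\<theta> < 1"
  obtains F :: "('a::banach \<Rightarrow>\<^sub>L real) \<Rightarrow>\<^sub>L real"
  where "norm F = 1" "\<And>x. \<theta> < norm (F - canonical_embedding x)"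
proof -
  let ?J = "canonical_embedding :: 'a \<Rightarrow> _"
  obtain G where G: "G \<notin> range ?J"
    using assms(1) unfolding reflexive_space_def by (metis canonical_embedding_apply rangeE)
  have "complete (range ?J)"
    by (rule complete_isometric_image[OF zero_less_one _ bounded_linear_canonical_embedding])
      (auto simp: norm_canonical_embedding complete_UNIV)
  then have "closed (range ?J)" by (rule complete_imp_closed)
  then obtain d where d: "d > 0" "\<And>x. d \<le> dist G (?J x)"
    using closed_separated_point[OF _ G] by (metis rangeI)
  define m where "m = (INF x. norm (G - ?J x))"
  have bdd: "bdd_below (range (\<lambda>x. norm (G - ?J x)))" by (rule bdd_belowI2[of _ 0]) simp
  have "d \<le> m" unfolding m_def using d by (intro cINF_greatest) (auto simp: dist_norm)
  then have "m > 0" using d by simp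
  \<comment> \<open>Room for an almost nearest point: its distance from \<open>G\<close> exceeds the
    infimum \<open>m\<close> by a factor below \<open>1 / \<theta>\<close>.\<close>
  then have "m < m / \<theta>" using \<theta> by (simp add: field_simps)
  then obtain x where x: "norm (G - ?J x) < m / \<theta>"
    unfolding m_def using cINF_less_iff[OF _ bdd] by auto
  have m: "m \<le> norm (G - ?J y)" for y unfolding m_def by (rule cINF_lower[OF bdd]) simp
  define r where "r = norm (G - ?J x)"
  have r: "r > 0" "\<theta> * r < m" using m[of x] \<open>m > 0\<close> x \<theta> by (auto simp: r_def field_simps)
  show ?thesis
  proof
    show "norm ((1 / r) *\<^sub>R (G - ?J x)) = 1" using r by (simp add: r_def[symmetric])
    show "\<theta> < norm ((1 / r) *\<^sub>R (G - ?J x) - ?J y)" for y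
    proof -
      have "?J (x + r *\<^sub>R y) = ?J x + r *\<^sub>R ?J y"
        by (simp add: linear_simps(1,5)[OF bounded_linear_canonical_embedding])
      then have "(1 / r) *\<^sub>R (G - ?J x) - ?J y = (1 / r) *\<^sub>R (G - ?J (x + r *\<^sub>R y))"
        using r by (simp add: algebra_simps)
      moreover have "\<theta> < norm (G - ?J (x + r *\<^sub>R y)) / r"
        using m[of "x + r *\<^sub>R y"] r by (simp add: field_simps)
      ultimately show ?thesis using r by simp
    qed
  qed
qed

text \<open>A unit vector \<open>F\<close> of the bidual far from the space yields functionals \<open>f1\<close>, \<open>f2\<close>, almost normed by
  \<open>F\<close> and hence close to each other, with \<open>f1 x1\<close> close to \<open>1\<close> but \<open>f2 x1 = 0\<close>.\<close>

theorem uniformly_smooth_imp_reflexive: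
  assumes "uniformly_smooth TYPE('a::banach)"
  shows "reflexive_space TYPE('a::banach)"
proof (rule ccontr)
  assume nonrefl: "\<not> reflexive_space TYPE('a)"
  obtain \<delta>0 where "\<delta>0 > 0" and \<delta>0: "\<And>(f :: 'a \<Rightarrow>\<^sub>L real) (g :: 'a \<Rightarrow>\<^sub>L real) x. norm f \<le> 1 \<Longrightarrow> norm g \<le> 1 \<Longrightarrow> norm x \<le> 1 \<Longrightarrow>
      blinfun_apply f x > 1 - \<delta>0 \<Longrightarrow> blinfun_apply g x > 1 - \<delta>0 \<Longrightarrow> norm (f - g) \<le> 1/2"
    using assms[unfolded uniformly_smooth_def, rule_format, of "1/2"] by fastforce
  \<comment> \<open>The 3 pays for the defects \<delta> and \<open>2 * \<delta>\<close> of
    \<open>f1\<close> and \<open>f2\<close> under \<open>F\<close>; the bound 1/4 makes the final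
    gap \<open>1 - \<delta>\<close> exceed 1/2.\<close>
  define \<delta> where "\<delta> = min (\<delta>0 / 3) (1/4)"
  have \<delta>: "\<delta> > 0" "3 * \<delta> \<le> \<delta>0" "\<delta> \<le> 1/4" using \<open>\<delta>0 > 0\<close> by (auto simp: \<delta>_def)
  obtain F :: "('a \<Rightarrow>\<^sub>L real) \<Rightarrow>\<^sub>L real"
    where F: "norm F = 1" and far: "\<And>x. 1 - \<delta> < norm (F - canonical_embedding x)"
    by (rule far_from_canonical_embedding[OF nonrefl, of "1 - \<delta>"]) (use \<delta> in auto)
  have Fle: "F f \<le> norm f" for f using blinfun_le[of F 1 f "norm f"] F by simp
  obtain f1 where f1: "norm f1 \<le> 1" "1 - \<delta> < F f1"
    by (rule near_norming_vector[of "1 - \<delta>" F]) (use \<delta> F in auto)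
  obtain x1 where x1: "norm x1 \<le> 1" "1 - \<delta> < f1 x1"
    by (rule near_norming_vector[of "1 - \<delta>" f1]) (use \<delta> f1 Fle[of f1] in auto)
  \<comment> \<open>Otherwise \<open>F\<close> would be within \<open>1 - 2 * \<delta>\<close> of
    the image of a multiple of \<open>x1\<close>, against \<open>far\<close>.\<close>
  obtain h where h: "blinfun_apply h x1 = 0" "(1 - 2 * \<delta>) * norm h < F h"
  proof (rule ccontr)
    assume "\<not> thesis"
    then have "\<And>h. blinfun_apply h x1 = 0 \<Longrightarrow> F h \<le> (1 - 2 * \<delta>) * norm h" using that by (meson not_le)
    then obtain t where t: "\<And>f. F f - t * blinfun_apply f x1 \<le> (1 - 2 * \<delta>) * norm f"
      using annihilator_functional[of "1 - 2 * \<delta>" x1 F] \<delta> by auto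
    have "norm (F - canonical_embedding (t *\<^sub>R x1)) \<le> 1 - 2 * \<delta>"
    proof (rule blinfun_norm_le)
      fix f :: "'a \<Rightarrow>\<^sub>L real" assume "norm f \<le> 1"
      then have "(1 - 2 * \<delta>) * norm f \<le> 1 - 2 * \<delta>" using \<delta> by (simp add: mult_left_le)
      with t[of f] show "(F - canonical_embedding (t *\<^sub>R x1)) f \<le> 1 - 2 * \<delta>"
        by (simp add: blinfun.diff_left blinfun.scaleR_right)
    qed (use \<delta> in simp)
    with far[of "t *\<^sub>R x1"] \<delta> show False by simp
  qed
  define f2 where "f2 = (1 / norm h) *\<^sub>R h"
  have "h \<noteq> 0" using h by (auto simp: blinfun.zero_right)
  then have f2: "norm f2 \<le> 1" "f2 x1 = 0" "1 - 2 * \<delta> < F f2"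
    using h by (auto simp: f2_def blinfun.scaleR_left blinfun.scaleR_right field_simps)
  \<comment> \<open>The norm of \<open>f1 + f2\<close> is almost attained in the space itself, where
    the smoothness hypothesis applies.\<close>
  obtain x2 where x2: "norm x2 \<le> 1" "2 - 3 * \<delta> < (f1 + f2) x2"
    by (rule near_norming_vector[of "2 - 3 * \<delta>" "f1 + f2"])
      (use \<delta> f1 f2 Fle[of "f1 + f2"] in \<open>auto simp: blinfun.add_right\<close>)
  have "f1 x2 \<le> 1" "f2 x2 \<le> 1"
    using blinfun_le[OF f1(1) x2(1)] blinfun_le[OF f2(1) x2(1)] by auto
  then have "norm (f1 - f2) \<le> 1/2"
    using x2 \<delta> by (intro \<delta>0[OF f1(1) f2(1) x2(1)]) (auto simp: blinfun.add_left)
  then have "(f1 - f2) x1 \<le> 1/2" using blinfun_le[of "f1 - f2" "1/2" x1 1] x1 by simp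
  with x1 f2 \<delta> show False by (simp add: blinfun.diff_left)
qed

text \<open>Mazur-Orlicz on the dual, in place of weak compactness: a linear \<open>L\<close> below
  the support function \<open>p\<close> of \<open>K\<close> that agrees with it at \<open>f\<close>
  is bounded, hence evaluation at a point, and separation puts that point into
  \<open>K\<close>.\<close>

lemma sup_attained:
  fixes f :: "'a::real_normed_vector \<Rightarrow>\<^sub>L real"
  assumes refl: "reflexive_space TYPE('a::real_normed_vector)" and K: "closed K" "convex K" "bounded K" "K \<noteq> {}"
  obtains x where "x \<in> K" "\<And>y. y \<in> K \<Longrightarrow> f y \<le> f x"
proof -
  obtain B where B: "B > 0" "\<And>x. x \<in> K \<Longrightarrow> norm x \<le> B"
    using K(3) unfolding bounded_pos by auto
  define p where "p g = (SUP x\<in>K. blinfun_apply g x)" for g :: "'a \<Rightarrow>\<^sub>L real"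
  have bdd: "bdd_above (blinfun_apply g ` K)" for g :: "'a \<Rightarrow>\<^sub>L real"
    by (rule bdd_aboveI2[of _ _ "norm g * B"]) (use B(2) in \<open>auto intro: blinfun_le\<close>)
  have le: "blinfun_apply g x \<le> p g" if "x \<in> K" for g x unfolding p_def by (rule cSUP_upper[OF that bdd])
  have ge: "p g \<le> c" if "\<And>x. x \<in> K \<Longrightarrow> blinfun_apply g x \<le> c" for g c
    unfolding p_def by (rule cSUP_least[OF K(4) that])
  have "sublinear p"
  proof (rule sublinearI)
    show "p (g + h) \<le> p g + p h" for g h
      by (rule ge) (auto simp: blinfun.add_left intro: add_mono le)
    show "p (t *\<^sub>R g) \<le> t * p g" if "t > 0" for t g
      by (rule ge) (use that in \<open>auto simp: blinfun.scaleR_left intro: le\<close>)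
    show "p 0 = 0" using K(4) by (simp add: p_def)
  qed
  then obtain L where L: "linear L" "L \<le> p" "p f \<le> L f"
    using mazur_orlicz[of p "{f}" "p f"] by auto
  have "L g \<le> B * norm g" for g
  proof -
    have "p g \<le> B * norm g" by (rule ge) (use B(2) in \<open>auto simp: mult.commute[of B] intro: blinfun_le\<close>)
    with L(2) show ?thesis by (meson le_funD order_trans)
  qed
  then obtain F :: "('a \<Rightarrow>\<^sub>L real) \<Rightarrow>\<^sub>L real" where F: "blinfun_apply F = L"
    using blinfun_of_linear[OF L(1), of B] B(1) by auto
  obtain x where x: "\<And>g. L g = blinfun_apply g x"
    using refl unfolding reflexive_space_def F[symmetric] by meson
  have "x \<in> K"
  proof (rule ccontr)
    assume "x \<notin> K"
    then obtain d where d: "d > 0" "\<And>k. k \<in> K \<Longrightarrow> d \<le> dist x k"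
      using closed_separated_point[OF K(1)] by metis
    obtain g :: "'a \<Rightarrow>\<^sub>L real" where g: "\<And>k. k \<in> K \<Longrightarrow> g k + d \<le> g x"
      using separating_functional[OF K(2,4), of d x] d by (metis dist_norm)
    have "p g \<le> g x - d" using g by (intro ge) (auto simp: algebra_simps)
    with L(2) x[of g] d show False by (auto simp: le_fun_def) (smt (verit))
  qed
  then show ?thesis
    by (rule that) (use le L(3) x in \<open>auto intro: order_trans\<close>)
qed

text \<open>The convex hull is the union of the compact hulls of the countably many finite subsets.
  Half of \<open>e\<close> covers these, the other half absorbs the closure.\<close>

lemma countable_ball_cover:
  fixes A :: "'a::real_normed_vector set"
  assumes "countable A" "e > 0"
  obtains D where "countable D" "closure (convex hull A) \<subseteq> (\<Union>x\<in>D. cball x e)"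
proof -
  define \<F> where "\<F> = {S. finite S \<and> S \<subseteq> A}"
  have "\<exists>k. finite k \<and> convex hull S \<subseteq> (\<Union>x\<in>k. ball x (e/2))" if "S \<in> \<F>" for S
    using compact_eq_totally_bounded[THEN iffD1, OF finite_imp_compact_convex_hull[of S]] that \<open>e > 0\<close>
    by (simp add: \<F>_def)
  then obtain k where k: "\<And>S. S \<in> \<F> \<Longrightarrow> finite (k S) \<and> convex hull S \<subseteq> (\<Union>x\<in>k S. ball x (e/2))"
    by metis
  show ?thesis
  proof
    have "countable \<F>" unfolding \<F>_def by (rule countable_Collect_finite_subset[OF assms(1)])
    then show "countable (\<Union>S\<in>\<F>. k S)" using k by (intro countable_UN) (auto intro: countable_finite)
    show "closure (convex hull A) \<subseteq> (\<Union>x\<in>(\<Union>S\<in>\<F>. k S). cball x e)"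
    proof
      fix y assume "y \<in> closure (convex hull A)"
      then obtain z where z: "z \<in> convex hull A" "dist z y < e/2"
        using \<open>e > 0\<close> unfolding closure_approachable by (meson half_gt_zero)
      obtain S where S: "S \<in> \<F>" "z \<in> convex hull S"
      proof -
        obtain S u where "finite S" "S \<subseteq> A" "\<forall>x\<in>S. 0 \<le> u x" "sum u S = 1" "(\<Sum>v\<in>S. u v *\<^sub>R v) = z"
          using z(1) unfolding convex_hull_explicit by auto
        then show ?thesis
          by (intro that[of S]) (auto simp: \<F>_def convex_hull_finite)
      qed
      have "z \<in> (\<Union>x\<in>k S. ball x (e/2))" using k[OF S(1)] S(2) by blast
      then obtain x where "x \<in> k S" "dist x z < e/2" by auto
      moreover have "dist x y \<le> e" using dist_triangle[of x y z] z(2) \<open>dist x z < e/2\<close> by simp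
      ultimately show "y \<in> (\<Union>x\<in>(\<Union>S\<in>\<F>. k S). cball x e)" using S by auto
    qed
  qed
qed

section \<open>Small slices\<close>

text \<open>Cover the closed convex hull \<open>K\<close> by countably many small balls. Functionals attain their supremum
  on \<open>K\<close>, so by Baire's theorem those whose supremum on \<open>K\<close> is the one on a single ball contain a ball
  around some \<open>f0\<close>; tilting \<open>f0\<close> towards a far point shows that the slices of \<open>f0\<close> stay near that ball.\<close>

lemma small_slice:
  fixes A :: "'a::real_normed_vector set"
  assumes refl: "reflexive_space TYPE('a)"
    and A: "countable A" "bounded A" "A \<noteq> {}" and "e > 0"
  obtains f :: "'a \<Rightarrow>\<^sub>L real" and \<alpha> x where "\<alpha> > 0"
    "\<And>a. a \<in> A \<Longrightarrow> (\<And>b. b \<in> A \<Longrightarrow> f b \<le> f a + \<alpha>) \<Longrightarrow> dist x a \<le> e"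
proof -
  define K where "K = closure (convex hull A)"
  have "A \<subseteq> K" unfolding K_def by (meson closure_subset hull_subset order_trans)
  have K: "closed K" "convex K" "bounded K" "K \<noteq> {}"
    using A by (auto simp: K_def intro: convex_closure bounded_convex_hull)
  obtain B where B: "B > 0" "\<And>x. x \<in> K \<Longrightarrow> norm x \<le> B"
    using K(3) unfolding bounded_pos by auto
  obtain D where D: "countable D" "K \<subseteq> (\<Union>x\<in>D. cball x (e/2))"
    using countable_ball_cover[OF A(1), of "e/2"] \<open>e > 0\<close> unfolding K_def by auto
  \<comment> \<open>For \<open>f\<close> in \<open>G x\<close> the supremum over \<open>K\<close> is
    already the one over \<open>K \<inter> cball x (e/2)\<close>; the phrasing excludes an empty
    intersection.\<close>
  define G where "G x = {f :: 'a \<Rightarrow>\<^sub>L real. \<forall>y\<in>K. \<forall>\<eta>>0. \<exists>z\<in>K \<inter> cball x (e/2). blinfun_apply f y \<le> blinfun_apply f z + \<eta>}" for x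
  have "closed (G x)" for x
    unfolding closed_def open_contains_ball
  proof (rule ballI)
    fix f assume "f \<in> - G x"
    then obtain y \<eta> where y: "y \<in> K" "\<eta> > 0"
        "\<And>z. z \<in> K \<inter> cball x (e/2) \<Longrightarrow> blinfun_apply f z + \<eta> < blinfun_apply f y"
      by (auto simp: G_def not_le)
    \<comment> \<open>On this ball values at points of \<open>K\<close> move by at most
      \<open>\<eta> / 4\<close>, so half of the gap \<eta> survives.\<close>
    have "ball f (\<eta> / (4 * B)) \<subseteq> - G x"
    proof
      fix g assume "g \<in> ball f (\<eta> / (4 * B))"
      then have "norm (f - g) \<le> \<eta> / (4 * B)" by (simp add: dist_norm)
      then have *: "\<bar>f w - g w\<bar> \<le> \<eta> / 4" if "w \<in> K" for w
        using blinfun_le[of "f - g" "\<eta> / (4 * B)" w B] blinfun_le[of "f - g" "\<eta> / (4 * B)" "- w" B]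
          B that unfolding abs_le_iff by (auto simp: blinfun.diff_left blinfun.minus_right)
      have "g z + \<eta> / 2 < g y" if "z \<in> K \<inter> cball x (e/2)" for z
        using y(3)[OF that] y(2) *[THEN abs_le_D2, of z] *[THEN abs_le_D1, OF y(1)] that by force
      then show "g \<in> - G x"
        using y(1,2) unfolding G_def by (auto simp: not_le intro!: bexI[of _ y] exI[of _ "\<eta>/2"])
    qed
    then show "\<exists>e>0. ball f e \<subseteq> - G x" using y(2) B(1) by (intro exI[of _ "\<eta> / (4 * B)"]) auto
  qed
  moreover have "(\<Union>x\<in>D. G x) = UNIV"
  proof (intro equalityI subset_UNIV subsetI)
    fix f :: "'a \<Rightarrow>\<^sub>L real"
    \<comment> \<open>Reflexivity enters here: the maximum is attained at a point, and that point
      lies in one of the balls.\<close>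
    obtain z where z: "z \<in> K" "\<And>y. y \<in> K \<Longrightarrow> f y \<le> f z"
      using sup_attained[OF refl K] by metis
    obtain x where x: "x \<in> D" "z \<in> cball x (e/2)" using z(1) D(2) by auto
    have "f y \<le> f z + \<eta>" if "y \<in> K" "\<eta> > 0" for y \<eta>
      using z(2)[OF that(1)] that(2) by simp
    then have "f \<in> G x" using z(1) x(2) unfolding G_def by blast
    then show "f \<in> (\<Union>x\<in>D. G x)" using x(1) by blast
  qed
  ultimately have "\<exists>x\<in>D. interior (G x) \<noteq> {}"
    using Baire_category_alt[of "euclidean :: ('a \<Rightarrow>\<^sub>L real) topology" "G ` D"] D(1)
      completely_metrizable_space_euclidean
    by (auto simp: interior_of_def interior_def)
  then obtain x f0 r where r: "r > 0" "ball f0 r \<subseteq> G x"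
    using mem_interior by blast
  \<comment> \<open>With \<open>norm u \<le> 1\<close> the tilt \<open>s *\<^sub>R u\<close> stays
    in the ball of radius \<open>r\<close>. The slice depth \<open>s * e / 4\<close> and an equal
    slack in \<open>G x\<close> together cost \<open>s * e / 2\<close>.\<close>
  define s where "s = r / 2"
  show ?thesis
  proof (rule that[of "s * e / 4" f0 x])
    show "s * e / 4 > 0" using r \<open>e > 0\<close> by (simp add: s_def)
    fix a assume a: "a \<in> A" "\<And>b. b \<in> A \<Longrightarrow> f0 b \<le> f0 a + s * e / 4"
    \<comment> \<open>The point \<open>z\<close> found below lies in \<open>K\<close>, perhaps
      outside \<open>A\<close>; a closed half-space extends the slice inequality from
      \<open>A\<close> to \<open>K\<close>.\<close>
    define H where "H = {b. f0 b \<le> f0 a + s * e / 4}"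
    have "convex H"
      using convex_linear_vimage[OF bounded_linear.linear[OF blinfun.bounded_linear_right[of f0]], of "{..f0 a + s * e / 4}"]
      by (simp add: H_def vimage_def)
    moreover have "closed H" unfolding H_def by (intro closed_Collect_le continuous_intros)
    ultimately have KH: "K \<subseteq> H"
      unfolding K_def using a(2) by (intro closure_minimal hull_minimal) (auto simp: H_def)
    show "dist x a \<le> e"
    proof (rule ccontr)
      assume "\<not> dist x a \<le> e"
      then have far: "e < norm (a - x)" by (simp add: dist_norm norm_minus_commute)
      obtain u :: "'a \<Rightarrow>\<^sub>L real" where u: "norm u \<le> 1" "u (a - x) = norm (a - x)"
        by (rule norming_functional)
      have "norm (s *\<^sub>R u) \<le> s" using u(1) r(1) by (simp add: s_def)
      then have "f0 + s *\<^sub>R u \<in> ball f0 r" using r(1) by (simp add: dist_norm s_def)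
      then have "f0 + s *\<^sub>R u \<in> G x" using r(2) by blast
      moreover have "a \<in> K" using a(1) \<open>A \<subseteq> K\<close> by blast
      moreover have "s * e / 4 > 0" using r(1) \<open>e > 0\<close> by (simp add: s_def)
      ultimately have "\<exists>z\<in>K \<inter> cball x (e/2). (f0 + s *\<^sub>R u) a \<le> (f0 + s *\<^sub>R u) z + s * e / 4"
        unfolding G_def by blast
      then obtain z where z: "z \<in> K" "dist x z \<le> e/2" "(f0 + s *\<^sub>R u) a \<le> (f0 + s *\<^sub>R u) z + s * e / 4"
        by auto
      have "f0 z \<le> f0 a + s * e / 4" using KH z(1) by (auto simp: H_def)
      with z(3) have "s * u (a - z) \<le> s * (e / 2)"
        by (simp add: blinfun.add_left blinfun.scaleR_left blinfun.diff_right right_diff_distrib)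
      then have "u (a - z) \<le> e / 2" using r(1) by (simp add: s_def)
      moreover have "u (z - x) \<le> e / 2"
        using blinfun_le[OF u(1), of "z - x" "e/2"] z(2) by (simp add: dist_norm norm_minus_commute)
      ultimately show False using u(2) far by (simp add: blinfun.diff_right)
    qed
  qed
qed

section \<open>Geometry of uniformly micro-semitransitive norms\<close>

definition uniformly_convex :: "'a::real_normed_vector itself \<Rightarrow> bool" where
  "uniformly_convex _ \<longleftrightarrow> (\<forall>\<epsilon>>0. \<exists>\<delta>>0. \<forall>(x :: 'a) y.
    norm x \<le> 1 \<longrightarrow> norm y \<le> 1 \<longrightarrow> norm (x + y) > 2 - \<delta> \<longrightarrow> norm (x - y) \<le> \<epsilon>)"

text \<open>An arbitrary set \<open>G\<close> of operators, so that contractions and surjective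
  isometries are treated together; \<delta> is uniform in the point \<open>x\<close>.\<close>

definition uniformly_micro :: "('a::real_normed_vector \<Rightarrow>\<^sub>L 'a) set \<Rightarrow> bool" where
  "uniformly_micro G \<longleftrightarrow> (\<forall>\<epsilon>>0. \<exists>\<delta>>0. \<forall>x y. norm x = 1 \<longrightarrow> norm y = 1 \<longrightarrow> norm (x - y) < \<delta> \<longrightarrow>
    (\<exists>T\<in>G. blinfun_apply T x = y \<and> norm (T - id_blinfun) < \<epsilon>))"

section \<open>Uniform smoothness from operators near the identity\<close>

lemma norm_sgn_diff_le:
  fixes a b :: "'a::real_normed_vector"
  assumes "a \<noteq> 0"
  shows "norm (sgn a - sgn b) \<le> 2 * norm (a - b) / norm a"
proof (cases "b = 0")
  case False
  have "(norm b - norm a) *\<^sub>R sgn b = b - norm a *\<^sub>R sgn b"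
    using False by (subst scaleR_diff_left) (simp add: sgn_div_norm)
  then have "sgn a - sgn b = (1 / norm a) *\<^sub>R ((a - b) + (norm b - norm a) *\<^sub>R sgn b)"
    using assms by (simp add: scaleR_diff_right sgn_div_norm[of a] inverse_eq_divide)
  also have "norm \<dots> \<le> (1 / norm a) * (norm (a - b) + \<bar>norm b - norm a\<bar>)"
    using norm_triangle_ineq[of "a - b" "(norm b - norm a) *\<^sub>R sgn b"] False assms
    by (simp add: norm_sgn divide_right_mono)
  also have "\<dots> \<le> (1 / norm a) * (2 * norm (a - b))"
    using norm_triangle_ineq3[of a b] by (intro mult_left_mono) (auto simp: abs_minus_commute)
  finally show ?thesis by simp
qed (use assms in \<open>simp add: norm_sgn\<close>)

text \<open>With \<open>f\<close> norming \<open>b\<close> and \<open>T\<close> turning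
  \<open>a\<close> into the direction of \<open>b\<close>, both norms are values of
  \<open>f\<close>, namely \<open>f (T a)\<close> and \<open>f b\<close>. The parts in
  \<open>x\<close> contribute at most 2 because \<open>T\<close> is a contraction; the parts in
  \<open>z\<close> contribute \<tau> times \<open>f (T z) - f z\<close>.\<close>

lemma uniformly_micro_imp_small_second_difference:
  assumes G: "uniformly_micro (G :: ('a::real_normed_vector \<Rightarrow>\<^sub>L 'a) set)" "\<forall>T\<in>G. norm T \<le> 1" and "\<epsilon> > 0"
  obtains \<tau> where "\<tau> > 0" "\<And>x z :: 'a. norm x = 1 \<Longrightarrow> norm z \<le> 1 \<Longrightarrow>
    norm (x + \<tau> *\<^sub>R z) + norm (x - \<tau> *\<^sub>R z) \<le> 2 + \<tau> * \<epsilon>"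
proof -
  obtain \<delta> where \<delta>: "\<delta> > 0" "\<And>x y :: 'a. norm x = 1 \<Longrightarrow> norm y = 1 \<Longrightarrow> norm (x - y) < \<delta> \<Longrightarrow>
      \<exists>T\<in>G. blinfun_apply T x = y \<and> norm (T - id_blinfun) < \<epsilon>"
    using G(1) \<open>\<epsilon> > 0\<close> unfolding uniformly_micro_def by meson
  \<comment> \<open>\<open>\<tau> \<le> 1/2\<close> keeps \<open>a\<close> and \<open>b\<close> at
    norm at least 1/2, so normalising turns their distance \<open>2 * \<tau>\<close> into at most
    \<open>8 * \<tau> < \<delta>\<close>.\<close>
  define \<tau> where "\<tau> = min (1/2) (\<delta> / 16)"
  have \<tau>: "\<tau> > 0" "\<tau> \<le> 1/2" "8 * \<tau> < \<delta>" using \<delta>(1) by (auto simp: \<tau>_def)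
  show ?thesis
  proof (rule that[OF \<tau>(1)])
    fix x z :: 'a assume x: "norm x = 1" and z: "norm z \<le> 1"
    define a b where "a = x + \<tau> *\<^sub>R z" and "b = x - \<tau> *\<^sub>R z"
    have \<tau>z: "norm (\<tau> *\<^sub>R z) \<le> \<tau>" using \<tau> z by (simp add: mult_left_le)
    have ab: "norm a \<ge> 1/2" "norm b \<ge> 1/2"
      using norm_diff_ineq[of x "\<tau> *\<^sub>R z"] norm_triangle_ineq2[of x "\<tau> *\<^sub>R z"] \<tau>z \<tau>(2) x
      unfolding a_def b_def by linarith+
    then have nz: "a \<noteq> 0" "b \<noteq> 0" by auto
    have "a - b = 2 *\<^sub>R (\<tau> *\<^sub>R z)" unfolding a_def b_def scaleR_2 by simp
    then have "norm (a - b) \<le> 2 * \<tau>" using \<tau>z by simp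
    then have "2 * norm (a - b) / norm a \<le> (4 * \<tau>) / (1/2)"
      using ab \<tau> by (intro frac_le) auto
    then have "norm (sgn a - sgn b) < \<delta>"
      using norm_sgn_diff_le[OF nz(1), of b] \<tau> by simp
    then obtain T where T: "T \<in> G" "T (sgn a) = sgn b" "norm (T - id_blinfun) < \<epsilon>"
      using \<delta>(2)[of "sgn a" "sgn b"] nz by (auto simp: norm_sgn)
    obtain f :: "'a \<Rightarrow>\<^sub>L real" where f: "norm f \<le> 1" "f (sgn b) = norm (sgn b)"
      by (rule norming_functional)
    have a_sgn: "a = norm a *\<^sub>R sgn a" and b_sgn: "b = norm b *\<^sub>R sgn b"
      using nz by (simp_all add: sgn_div_norm)
    have "f (T a) = norm a"
      using T(2) f(2) nz by (subst a_sgn) (simp add: blinfun.scaleR_right norm_sgn)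
    moreover have "f b = norm b"
      using f(2) nz by (subst b_sgn) (simp add: blinfun.scaleR_right norm_sgn)
    moreover have "f x \<le> 1" using blinfun_le[OF f(1), of x 1] x by simp
    moreover have "f (T x) \<le> 1"
    proof -
      have "norm (T x) \<le> 1" using norm_blinfun[of T x] bspec[OF G(2) T(1)] x by simp
      then show ?thesis using blinfun_le[OF f(1), of "T x" 1] by simp
    qed
    moreover have "f (T z) - f z \<le> \<epsilon>"
    proof -
      have "norm ((T - id_blinfun) z) \<le> norm (T - id_blinfun) * norm z" by (rule norm_blinfun)
      also have "\<dots> \<le> \<epsilon> * 1" using T(3) z \<open>\<epsilon> > 0\<close> by (intro mult_mono) auto
      finally have "norm (T z - z) \<le> \<epsilon>" by (simp add: blinfun.diff_left)
      then show ?thesis using blinfun_le[OF f(1), of "T z - z" \<epsilon>] by (simp add: blinfun.diff_right)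
    qed
    then have "\<tau> * (f (T z) - f z) \<le> \<tau> * \<epsilon>" using \<tau> by (intro mult_left_mono) auto
    ultimately show "norm (x + \<tau> *\<^sub>R z) + norm (x - \<tau> *\<^sub>R z) \<le> 2 + \<tau> * \<epsilon>"
      unfolding a_def[symmetric] b_def[symmetric]
      by (simp add: a_def b_def blinfun.add_right blinfun.diff_right blinfun.scaleR_right right_diff_distrib)
  qed
qed

text \<open>If \<open>f\<close> and \<open>g\<close> are almost 1 at a unit vector \<open>x\<close>,
  evaluating \<open>f\<close> at \<open>x + \<tau> *\<^sub>R z\<close> and \<open>g\<close> at
  \<open>x - \<tau> *\<^sub>R z\<close> bounds \<tau> times \<open>(f - g) z\<close> by
  \<open>\<tau> * (\<epsilon> / 2) + 2 * \<delta>\<close>.\<close>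

theorem uniformly_micro_imp_uniformly_smooth:
  assumes G: "uniformly_micro (G :: ('a::real_normed_vector \<Rightarrow>\<^sub>L 'a) set)" "\<forall>T\<in>G. norm T \<le> 1"
  shows "uniformly_smooth TYPE('a)"
  unfolding uniformly_smooth_def
proof (intro allI impI)
  fix \<epsilon> :: real assume "\<epsilon> > 0"
  obtain \<tau> where \<tau>: "\<tau> > 0" "\<And>x z :: 'a. norm x = 1 \<Longrightarrow> norm z \<le> 1 \<Longrightarrow>
    norm (x + \<tau> *\<^sub>R z) + norm (x - \<tau> *\<^sub>R z) \<le> 2 + \<tau> * (\<epsilon> / 2)"
    using uniformly_micro_imp_small_second_difference[OF G, of "\<epsilon> / 2"] \<open>\<epsilon> > 0\<close> by auto
  define \<delta> where "\<delta> = min (1/2) (\<tau> * \<epsilon> / 4)"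
  have \<delta>: "\<delta> > 0" "\<delta> \<le> 1/2" "2 * \<delta> \<le> \<tau> * \<epsilon> / 2" using \<tau>(1) \<open>\<epsilon> > 0\<close> by (auto simp: \<delta>_def)
  show "\<exists>\<delta>>0. \<forall>(f :: 'a \<Rightarrow>\<^sub>L real) (g :: 'a \<Rightarrow>\<^sub>L real) x. norm f \<le> 1 \<longrightarrow> norm g \<le> 1 \<longrightarrow> norm x \<le> 1 \<longrightarrow>
    blinfun_apply f x > 1 - \<delta> \<longrightarrow> blinfun_apply g x > 1 - \<delta> \<longrightarrow> norm (f - g) \<le> \<epsilon>"
  proof (intro exI[of _ \<delta>] conjI \<delta>(1) allI impI)
    fix f g :: "'a \<Rightarrow>\<^sub>L real" and x :: 'a
    assume fg: "norm f \<le> 1" "norm g \<le> 1" and x: "norm x \<le> 1"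
      and big: "1 - \<delta> < f x" "1 - \<delta> < g x"
    have "x \<noteq> 0" using big(1) \<delta>(2) by auto
    \<comment> \<open>Normalising \<open>x\<close> only raises positive values, so the unit ball
      reduces to the sphere.\<close>
    have sgn_ge: "1 - \<delta> < h (sgn x)" if "1 - \<delta> < h x" for h :: "'a \<Rightarrow>\<^sub>L real"
    proof -
      have "h x \<le> h x / norm x" using that \<delta>(2) x \<open>x \<noteq> 0\<close> by (simp add: field_simps mult_left_le)
      then show ?thesis using that by (simp add: sgn_div_norm blinfun.scaleR_right field_simps)
    qed
    show "norm (f - g) \<le> \<epsilon>"
    proof (rule blinfun_norm_le)
      fix z :: 'a assume z: "norm z \<le> 1"
      have "f (sgn x + \<tau> *\<^sub>R z) + g (sgn x - \<tau> *\<^sub>R z) \<le> 2 + \<tau> * (\<epsilon> / 2)"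
        using \<tau>(2)[of "sgn x" z] z \<open>x \<noteq> 0\<close> blinfun_le[OF fg(1) order_refl, of "sgn x + \<tau> *\<^sub>R z"]
          blinfun_le[OF fg(2) order_refl, of "sgn x - \<tau> *\<^sub>R z"]
        by (simp add: norm_sgn)
      then have "\<tau> * (f - g) z \<le> \<tau> * \<epsilon>"
        using sgn_ge[OF big(1)] sgn_ge[OF big(2)] \<delta>(3)
        by (simp add: blinfun.add_right blinfun.diff_right blinfun.diff_left blinfun.scaleR_right right_diff_distrib)
      then show "(f - g) z \<le> \<epsilon>" using \<tau>(1) by simp
    qed (use \<open>\<epsilon> > 0\<close> in simp)
  qed
qed

section \<open>Contractions between arbitrary points of the sphere\<close>

lemma contraction_along_chain:
  fixes z :: "nat \<Rightarrow> 'a::real_normed_vector"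
  assumes step: "\<forall>x y :: 'a. norm x = 1 \<longrightarrow> norm y = 1 \<longrightarrow> norm (x - y) < \<delta> \<longrightarrow>
      (\<exists>T :: 'a \<Rightarrow>\<^sub>L 'a. norm T \<le> 1 \<and> blinfun_apply T x = y \<and> norm (T - id_blinfun) < 1/2)"
    and "\<And>i. i \<le> n \<Longrightarrow> norm (z i) = 1" "\<And>i. i < n \<Longrightarrow> norm (z i - z (Suc i)) < \<delta>"
  shows "\<exists>T :: 'a \<Rightarrow>\<^sub>L 'a. norm T \<le> 1 \<and> blinfun_apply T (z 0) = z n \<and> (\<forall>u. (1/2) ^ n * norm u \<le> norm (blinfun_apply T u))"
  using assms(2,3)
proof (induction n)
  case 0
  show ?case
    by (rule exI[of _ id_blinfun]) (auto intro: norm_blinfun_bound)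
next
  case (Suc n)
  then obtain T :: "'a \<Rightarrow>\<^sub>L 'a" where T: "norm T \<le> 1" "T (z 0) = z n" "\<And>u. (1/2) ^ n * norm u \<le> norm (T u)"
    by force
  obtain R :: "'a \<Rightarrow>\<^sub>L 'a" where R: "norm R \<le> 1" "R (z n) = z (Suc n)" "norm (R - id_blinfun) < 1/2"
    using step[rule_format, of "z n" "z (Suc n)"] Suc.prems by auto
  \<comment> \<open>An operator within 1/2 of the identity at most halves norms; this gives the
    factor \<open>(1/2) ^ n\<close> along the chain.\<close>
  have half: "1/2 * norm v \<le> norm (R v)" for v
  proof -
    have "norm ((R - id_blinfun) v) \<le> 1/2 * norm v"
      using norm_blinfun[of "R - id_blinfun" v] mult_right_mono[of "norm (R - id_blinfun)" "1/2" "norm v"] R(3)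
      by simp
    then show ?thesis using norm_triangle_ineq2[of v "v - R v"]
      by (simp add: blinfun.diff_left norm_minus_commute)
  qed
  show ?case
  proof (intro exI[of _ "R o\<^sub>L T"] conjI allI)
    show "norm (R o\<^sub>L T) \<le> 1"
      using norm_blinfun_compose[of R T] mult_mono[OF R(1) T(1)] by simp
    show "(1/2) ^ Suc n * norm u \<le> norm ((R o\<^sub>L T) u)" for u
      using half[of "T u"] T(3)[of u] by simp
  qed (use R T in simp)
qed

text \<open>The chain is the normalised segment from \<open>x\<close> to \<open>y\<close>, cut into
  \<open>N\<close> equal pieces; \<open>1 \<le> norm (x + y)\<close> keeps the segment away from the
  origin.\<close>

lemma contraction_chain_on_sphere:
  fixes x y :: "'a::real_normed_vector"
  assumes step: "\<forall>x y :: 'a. norm x = 1 \<longrightarrow> norm y = 1 \<longrightarrow> norm (x - y) < \<delta> \<longrightarrow>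
      (\<exists>T :: 'a \<Rightarrow>\<^sub>L 'a. norm T \<le> 1 \<and> blinfun_apply T x = y \<and> norm (T - id_blinfun) < 1/2)"
    and N: "20 < \<delta> * real N" "N > 0" and x: "norm x = 1" and y: "norm y = 1" and xy: "1 \<le> norm (x + y)"
  shows "\<exists>T :: 'a \<Rightarrow>\<^sub>L 'a. norm T \<le> 1 \<and> blinfun_apply T x = y \<and> (\<forall>u. (1/2) ^ N * norm u \<le> norm (blinfun_apply T u))"
proof -
  define p where "p t = (1 - t) *\<^sub>R x + t *\<^sub>R y" for t :: real
  \<comment> \<open>1/5 is the minimum over \<open>t\<close> of the larger of
    \<open>1 - 2 * t\<close> and \<open>3 * t - 1\<close>, the lower bounds obtained from the
    endpoint \<open>v\<close> and from the midpoint.\<close>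
  have half: "1/5 \<le> norm ((1 - t) *\<^sub>R v + t *\<^sub>R w)"
    if t: "0 \<le> t" "t \<le> 1/2" and v: "norm v = 1" "norm w = 1" "1 \<le> norm (v + w)" for t and v w :: 'a
  proof -
    let ?p = "(1 - t) *\<^sub>R v + t *\<^sub>R w"
    have "(1 - t) - t \<le> norm ?p"
      using norm_diff_ineq[of "(1 - t) *\<^sub>R v" "t *\<^sub>R w"] t v by simp
    moreover have "(1 - 2 * t) *\<^sub>R v = (1 - t) *\<^sub>R v - t *\<^sub>R v"
      by (simp add: scaleR_diff_left[symmetric])
    then have "t *\<^sub>R (v + w) = ?p - (1 - 2 * t) *\<^sub>R v"
      by (simp add: scaleR_add_right)
    then have "norm (t *\<^sub>R (v + w)) \<le> norm ?p + norm ((1 - 2 * t) *\<^sub>R v)"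
      using norm_triangle_ineq4[of ?p "(1 - 2 * t) *\<^sub>R v"] by simp
    then have "t * norm (v + w) \<le> norm ?p + (1 - 2 * t)" using t v by simp
    moreover have "t \<le> t * norm (v + w)" using t v mult_left_mono[of 1 "norm (v + w)" t] by simp
    ultimately show ?thesis by linarith
  qed
  have p: "1/5 \<le> norm (p t)" if "0 \<le> t" "t \<le> 1" for t
  proof (cases "t \<le> 1/2")
    case True then show ?thesis using half[of t x y] that x y xy by (simp add: p_def)
  next
    case False then show ?thesis
      using half[of "1 - t" y x] that x y xy by (simp add: p_def add.commute)
  qed
  define z where "z i = sgn (p (real i / real N))" for i
  have unit: "0 \<le> real i / real N" "real i / real N \<le> 1" if "i \<le> N" for i
    using that N(2) by auto
  have nz: "p (real i / real N) \<noteq> 0" if "i \<le> N" for i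
    using p[OF unit[OF that]] by auto
  have "\<exists>T :: 'a \<Rightarrow>\<^sub>L 'a. norm T \<le> 1 \<and> blinfun_apply T (z 0) = z N \<and> (\<forall>u. (1/2) ^ N * norm u \<le> norm (blinfun_apply T u))"
  proof (rule contraction_along_chain[OF step])
    show "norm (z i) = 1" if "i \<le> N" for i using nz[OF that] by (simp add: z_def norm_sgn)
    show "norm (z i - z (Suc i)) < \<delta>" if "i < N" for i
    proof -
      let ?a = "p (real i / real N)" and ?b = "p (real (Suc i) / real N)"
      have "?a - ?b = (1 / real N) *\<^sub>R (x - y)"
        by (simp add: p_def add_divide_distrib algebra_simps)
      then have "norm (?a - ?b) = norm (x - y) / N" by simp
      also have "\<dots> \<le> 2 / N" using norm_triangle_ineq4[of x y] x y by (intro divide_right_mono) auto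
      \<comment> \<open>Dividing by norms of at least 1/5 turns the step length \<open>2 / N\<close>
        into \<open>20 / N\<close>, whence the 20 in the hypothesis on \<open>N\<close>.\<close>
      finally have "2 * norm (?a - ?b) / norm ?a \<le> (2 * (2 / N)) / (1/5)"
        using p[OF unit[of i]] that by (intro frac_le) auto
      then have "norm (z i - z (Suc i)) \<le> 20 / N"
        using norm_sgn_diff_le[OF nz[of i], of ?b] that by (simp add: z_def)
      also have "\<dots> < \<delta>" using N by (simp add: field_simps)
      finally show ?thesis .
    qed
  qed
  then show ?thesis using N(2) x y by (simp add: z_def p_def sgn_div_norm)
qed

text \<open>\<open>N\<close>, and with it \<open>c = (1/2) ^ N\<close>, depends on \<delta> alone.
  Compositions may leave \<open>G\<close>, so only the norm bound is claimed for
  \<open>T\<close>.\<close>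

lemma uniformly_micro_imp_transitive:
  assumes G: "uniformly_micro (G :: ('a::real_normed_vector \<Rightarrow>\<^sub>L 'a) set)" "\<forall>T\<in>G. norm T \<le> 1"
  obtains c where "c > 0" "\<And>x y :: 'a. norm x = 1 \<Longrightarrow> norm y = 1 \<Longrightarrow>
    \<exists>T :: 'a \<Rightarrow>\<^sub>L 'a. norm T \<le> 1 \<and> blinfun_apply T x = y \<and> (\<forall>u. c * norm u \<le> norm (blinfun_apply T u))"
proof -
  obtain \<delta> where \<delta>: "\<delta> > 0" "\<And>x y :: 'a. norm x = 1 \<Longrightarrow> norm y = 1 \<Longrightarrow> norm (x - y) < \<delta> \<Longrightarrow>
      \<exists>T\<in>G. blinfun_apply T x = y \<and> norm (T - id_blinfun) < 1/2"
    using G(1)[unfolded uniformly_micro_def, rule_format, of "1/2"] by auto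
  have step: "\<forall>x y :: 'a. norm x = 1 \<longrightarrow> norm y = 1 \<longrightarrow> norm (x - y) < \<delta> \<longrightarrow>
      (\<exists>T :: 'a \<Rightarrow>\<^sub>L 'a. norm T \<le> 1 \<and> blinfun_apply T x = y \<and> norm (T - id_blinfun) < 1/2)"
    using \<delta>(2) G(2) by meson
  obtain N :: nat where "20 / \<delta> < real N" using reals_Archimedean2 by blast
  then have N: "20 < \<delta> * real N" "N > 0" using \<delta>(1) by (auto simp: field_simps intro: gr0I)
  show ?thesis
  proof (rule that)
    fix x y :: 'a assume x: "norm x = 1" and y: "norm y = 1"
    show "\<exists>T :: 'a \<Rightarrow>\<^sub>L 'a. norm T \<le> 1 \<and> blinfun_apply T x = y \<and> (\<forall>u. (1/2) ^ N * norm u \<le> norm (blinfun_apply T u))"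
    proof (cases "1 \<le> norm (x + y)")
      case True show ?thesis by (rule contraction_chain_on_sphere[OF step N x y True])
    next
      case False
      \<comment> \<open>Nearly antipodal points: \<open>- y\<close> is then reachable from
        \<open>x\<close>, and the negated operator leads to \<open>y\<close>.\<close>
      have "x + x = (x + y) + (x - y)" by simp
      then have "norm (2 *\<^sub>R x) \<le> norm (x + y) + norm (x - y)"
        by (metis norm_triangle_ineq scaleR_2)
      then have "1 \<le> norm (x + (- y))" using False x by simp
      from contraction_chain_on_sphere[OF step N x _ this] y
      obtain T :: "'a \<Rightarrow>\<^sub>L 'a" where "norm T \<le> 1" "T x = - y" "\<forall>u. (1/2) ^ N * norm u \<le> norm (T u)"
        by auto
      then show ?thesis by (intro exI[of _ "- T"]) (simp add: blinfun.minus_left)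
    qed
  qed simp
qed

text \<open>A pair \<open>p\<close>, \<open>q\<close> violating convexity is carried along by a
  contraction \<open>T\<close> that sends the direction of \<open>p + q\<close> to \<open>x\<close>.
  As \<open>T p + T q\<close> has norm almost 2, both images are nearly unit vectors, and the lower
  bound \<open>c\<close> keeps them apart.\<close>

lemma spread_midpoints:
  assumes G: "uniformly_micro (G :: ('a::real_normed_vector \<Rightarrow>\<^sub>L 'a) set)" "\<forall>T\<in>G. norm T \<le> 1"
    and not_convex: "\<not> uniformly_convex TYPE('a)"
  shows "\<exists>\<epsilon>>0. \<forall>(x :: 'a) \<eta>. norm x = 1 \<longrightarrow> \<eta> > 0 \<longrightarrow>
    (\<exists>u v. norm u = 1 \<and> norm v = 1 \<and> norm (u + v - 2 *\<^sub>R x) \<le> \<eta> \<and> \<epsilon> \<le> norm (u - v))"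
proof -
  obtain c where c: "c > 0" "\<And>x y :: 'a. norm x = 1 \<Longrightarrow> norm y = 1 \<Longrightarrow>
    \<exists>T :: 'a \<Rightarrow>\<^sub>L 'a. norm T \<le> 1 \<and> blinfun_apply T x = y \<and> (\<forall>u. c * norm u \<le> norm (blinfun_apply T u))"
    using uniformly_micro_imp_transitive[OF G] by metis
  obtain \<epsilon> where \<epsilon>: "\<epsilon> > 0" "\<And>\<delta>. \<delta> > 0 \<Longrightarrow> \<exists>(p :: 'a) q.
      norm p \<le> 1 \<and> norm q \<le> 1 \<and> norm (p + q) > 2 - \<delta> \<and> norm (p - q) > \<epsilon>"
    using not_convex unfolding uniformly_convex_def by (meson not_le)
  show ?thesis
  proof (intro exI[of _ "c * \<epsilon> / 2"] conjI allI impI)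
    show "c * \<epsilon> / 2 > 0" using c(1) \<epsilon>(1) by simp
    fix x :: 'a and \<eta> :: real assume x: "norm x = 1" and "\<eta> > 0"
    \<comment> \<open>\<open>\<eta> / 3\<close> for three error terms,
      \<open>c * \<epsilon> / 4\<close> so that two normalisations cost at most half of the
      separation, 1/2 to keep the vectors nonzero.\<close>
    define \<delta> where "\<delta> = min (1/2) (min (\<eta> / 3) (c * \<epsilon> / 4))"
    have \<delta>: "\<delta> > 0" "\<delta> \<le> 1/2" "\<delta> \<le> \<eta> / 3" "\<delta> \<le> c * \<epsilon> / 4"
      using \<open>\<eta> > 0\<close> c(1) \<epsilon>(1) by (auto simp: \<delta>_def)
    obtain p q :: 'a where pq: "norm p \<le> 1" "norm q \<le> 1" "norm (p + q) > 2 - \<delta>" "norm (p - q) > \<epsilon>"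
      using \<epsilon>(2)[OF \<delta>(1)] by blast
    have "p + q \<noteq> 0" using pq(3) \<delta>(2) by auto
    then obtain T :: "'a \<Rightarrow>\<^sub>L 'a" where T: "norm T \<le> 1" "T (sgn (p + q)) = x" "\<And>u. c * norm u \<le> norm (T u)"
      using c(2)[of "sgn (p + q)" x] x by (auto simp: norm_sgn)
    have T_le: "norm (T w) \<le> 1" if "norm w \<le> 1" for w
      using norm_blinfun[of T w] mult_mono[OF T(1) that] by simp
    have "T (p + q) = T (norm (p + q) *\<^sub>R sgn (p + q))"
      using \<open>p + q \<noteq> 0\<close> by (simp add: sgn_div_norm)
    then have sum: "T p + T q = norm (p + q) *\<^sub>R x"
      using T(2) by (simp add: blinfun.scaleR_right blinfun.add_right)
    then have "norm (T p + T q) > 2 - \<delta>" using pq(3) x by simp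
    then have large: "norm (T p) > 1 - \<delta>" "norm (T q) > 1 - \<delta>"
      using norm_triangle_ineq[of "T p" "T q"] T_le[OF pq(1)] T_le[OF pq(2)] by linarith+
    have sgn_close: "norm (sgn w - w) \<le> \<delta>" if "norm w \<le> 1" "norm w > 1 - \<delta>" for w :: 'a
    proof -
      have "w \<noteq> 0" using that \<delta>(2) by auto
      then have "sgn w - w = (1 - norm w) *\<^sub>R sgn w" by (subst scaleR_diff_left) (simp add: sgn_div_norm)
      then show ?thesis using that \<open>w \<noteq> 0\<close> by (simp add: norm_sgn)
    qed
    note close = sgn_close[OF T_le[OF pq(1)] large(1)] sgn_close[OF T_le[OF pq(2)] large(2)]
    show "\<exists>u v. norm u = 1 \<and> norm v = 1 \<and> norm (u + v - 2 *\<^sub>R x) \<le> \<eta> \<and> c * \<epsilon> / 2 \<le> norm (u - v)"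
    proof (intro exI conjI)
      show "norm (sgn (T p)) = 1" "norm (sgn (T q)) = 1" using large \<delta>(2) by (auto simp: norm_sgn)
      have "norm (p + q) \<le> 2" using norm_triangle_ineq[of p q] pq by simp
      then have rest: "norm ((norm (p + q) - 2) *\<^sub>R x) \<le> \<delta>" using pq(3) x by simp
      have eq: "sgn (T p) + sgn (T q) - 2 *\<^sub>R x =
          (sgn (T p) - T p) + (sgn (T q) - T q) + (norm (p + q) - 2) *\<^sub>R x"
        using sum by (simp add: algebra_simps)
      show "norm (sgn (T p) + sgn (T q) - 2 *\<^sub>R x) \<le> \<eta>"
        unfolding eq using rest close \<delta>(3) norm_triangle_ineq[of "(sgn (T p) - T p) + (sgn (T q) - T q)" "(norm (p + q) - 2) *\<^sub>R x"]
          norm_triangle_ineq[of "sgn (T p) - T p" "sgn (T q) - T q"] by linarith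
      have "c * \<epsilon> \<le> c * norm (p - q)" using pq(4) c(1) by simp
      also have "\<dots> \<le> norm (T p - T q)" using T(3)[of "p - q"] by (simp add: blinfun.diff_right)
      also have "T p - T q = (sgn (T p) - sgn (T q)) - (sgn (T p) - T p) + (sgn (T q) - T q)" by simp
      also have "norm \<dots> \<le> norm (sgn (T p) - sgn (T q)) + \<delta> + \<delta>"
        by (intro norm_triangle_le norm_triangle_le_diff add_mono close order_refl)
      finally show "c * \<epsilon> / 2 \<le> norm (sgn (T p) - sgn (T q))" using \<delta>(4) by simp
    qed
  qed
qed

text \<open>Finite words in the maps \<open>h i\<close>, applied to \<open>x0\<close>, form the
  required set.\<close>

lemma countable_closed_under:
  fixes h :: "'i::countable \<Rightarrow> 'a \<Rightarrow> 'a"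
  assumes "x0 \<in> S" "\<And>i a. a \<in> S \<Longrightarrow> h i a \<in> S"
  obtains A where "countable A" "x0 \<in> A" "A \<subseteq> S" "\<And>i a. a \<in> A \<Longrightarrow> h i a \<in> A"
proof
  let ?A = "range (\<lambda>is. foldr h is x0)"
  show "countable ?A" by simp
  show "x0 \<in> ?A" by (rule range_eqI[of _ _ "[]"]) simp
  have "foldr h js x0 \<in> S" for js by (induction js) (use assms in auto)
  then show "?A \<subseteq> S" by auto
  show "h i a \<in> ?A" if a: "a \<in> ?A" for i a
  proof -
    obtain js where "a = foldr h js x0" using a by auto
    then show ?thesis by (intro range_eqI[of _ _ "i # js"]) simp
  qed
qed

text \<open>If \<open>a\<close> almost maximises \<open>f\<close> on \<open>A\<close>, then so do
  the two points of \<open>A\<close> of which \<open>a\<close> is nearly the midpoint. Both lie in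
  one slice although their distance is at least \<epsilon>, which a slice within radius
  \<open>\<epsilon> / 3\<close> forbids.\<close>

theorem uniformly_micro_imp_uniformly_convex:
  assumes G: "uniformly_micro (G :: ('a::banach \<Rightarrow>\<^sub>L 'a) set)" "\<forall>T\<in>G. norm T \<le> 1"
  shows "uniformly_convex TYPE('a)"
proof (cases "\<exists>x :: 'a. norm x = 1")
  case False
  \<comment> \<open>A nonzero vector would normalise to a unit vector, so the space is zero.\<close>
  have "x = 0" for x :: 'a
  proof -
    have "norm (sgn x) \<noteq> 1" using False by blast
    then show ?thesis by (simp add: norm_sgn split: if_splits)
  qed
  then have zero: "norm (x - y) = 0" for x y :: 'a by (simp only: norm_eq_zero)
  show ?thesis
    unfolding uniformly_convex_def zero by (intro allI impI exI[of _ 1]) simp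
next
  case True
  then obtain x0 :: 'a where x0: "norm x0 = 1" by blast
  have refl: "reflexive_space TYPE('a)"
    by (rule uniformly_smooth_imp_reflexive[OF uniformly_micro_imp_uniformly_smooth[OF G]])
  show ?thesis
  proof (rule ccontr)
    assume "\<not> uniformly_convex TYPE('a)"
    then obtain \<epsilon> where \<epsilon>: "\<epsilon> > 0" "\<forall>(x :: 'a) \<eta>. norm x = 1 \<longrightarrow> \<eta> > 0 \<longrightarrow>
        (\<exists>u v. norm u = 1 \<and> norm v = 1 \<and> norm (u + v - 2 *\<^sub>R x) \<le> \<eta> \<and> \<epsilon> \<le> norm (u - v))"
      using spread_midpoints[OF G] by blast
    \<comment> \<open>All precisions \<open>1 / real (Suc n)\<close> are built in, since the one
      required depends on \<open>f\<close>, which is known only once \<open>A\<close> is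
      fixed.\<close>
    define Q where "Q x n u v \<longleftrightarrow> norm u = 1 \<and> norm v = 1 \<and>
        norm (u + v - 2 *\<^sub>R x) \<le> 1 / real (Suc n) \<and> \<epsilon> \<le> norm (u - v)" for x u v :: 'a and n
    define U where "U x n = (SOME u. \<exists>v. Q x n u v)" for x n
    define V where "V x n = (SOME v. Q x n (U x n) v)" for x n
    have UV: "Q x n (U x n) (V x n)" if "norm x = 1" for x n
    proof -
      have "\<exists>u v. Q x n u v"
        using \<epsilon>(2)[rule_format, OF that, of "1 / real (Suc n)"] by (simp add: Q_def del: of_nat_Suc)
      then have "\<exists>v. Q x n (U x n) v" unfolding U_def by (rule someI_ex)
      then show ?thesis unfolding V_def by (rule someI_ex[of "Q x n (U x n)"])
    qed
    obtain A where A: "countable A" "x0 \<in> A" "A \<subseteq> {a. norm a = 1}"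
        "\<And>i a. a \<in> A \<Longrightarrow> (case i of (b, n) \<Rightarrow> \<lambda>a. if b then U a n else V a n) a \<in> A"
      by (rule countable_closed_under[of x0 "{a. norm a = 1}"
            "\<lambda>i. case i of (b :: bool, n) \<Rightarrow> \<lambda>a. if b then U a n else V a n"])
        (use x0 UV in \<open>simp_all add: Q_def split: prod.split\<close>)
    have sphere: "norm a = 1" if "a \<in> A" for a
      using A(3) that by auto
    have mem: "U a n \<in> A" "V a n \<in> A" if "a \<in> A" for a n
      using A(4)[OF that, of "(True, n)"] A(4)[OF that, of "(False, n)"] by auto
    have "bounded A" using sphere by (auto simp: bounded_iff intro!: exI[of _ 1])
    obtain f :: "'a \<Rightarrow>\<^sub>L real" and \<alpha> x where slice: "\<alpha> > 0"
        "\<And>a. a \<in> A \<Longrightarrow> (\<And>b. b \<in> A \<Longrightarrow> f b \<le> f a + \<alpha>) \<Longrightarrow> dist x a \<le> \<epsilon> / 3"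
      by (rule small_slice[OF refl A(1) \<open>bounded A\<close>, of "\<epsilon> / 3"]) (use A(2) \<epsilon>(1) in auto)
    have bdd: "bdd_above (f ` A)"
      by (rule bdd_aboveI2[of _ _ "norm f * 1"], rule blinfun_le) (simp_all add: sphere)
    obtain a where a: "a \<in> A" "(SUP a\<in>A. f a) - \<alpha> / 4 < f a"
      using less_cSUP_iff[OF _ bdd, of "(SUP a\<in>A. f a) - \<alpha> / 4"] A(2) slice(1) by auto
    have near_max: "f b \<le> f a + \<alpha> / 4" if "b \<in> A" for b
      using cSUP_upper[OF that bdd] a(2) by simp
    \<comment> \<open>Precision at which the midpoint error changes \<open>f\<close> by less than
      \<open>\<alpha> / 4\<close>.\<close>
    obtain n where n: "norm f / real (Suc n) < \<alpha> / 4"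
    proof -
      obtain n :: nat where "4 * norm f / \<alpha> < real n" using reals_Archimedean2 by blast
      then have "4 * norm f / \<alpha> < real (Suc n)" by simp
      then show ?thesis using slice(1) by (intro that[of n]) (simp add: field_simps del: of_nat_Suc)
    qed
    note uv = UV[OF sphere[OF a(1)], of n, unfolded Q_def]
    have "f (- (U a n + V a n - 2 *\<^sub>R a)) \<le> norm f * (1 / real (Suc n))"
      using uv by (intro blinfun_le) (simp_all only: norm_minus_cancel)
    then have sum: "2 * f a - \<alpha> / 4 \<le> f (U a n) + f (V a n)"
      using n by (simp only: blinfun.add_right blinfun.diff_right blinfun.minus_right blinfun.scaleR_right real_scaleR_def mult_1_right times_divide_eq_right)
    \<comment> \<open>The partner \<open>V a n\<close> exceeds \<open>f a\<close> by at most
      \<open>\<alpha> / 4\<close>, so \<open>f (U a n) \<ge> f a - \<alpha> / 2\<close>, within the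
      slice depth.\<close>
    have "dist x (U a n) \<le> \<epsilon> / 3"
    proof (rule slice(2)[OF mem(1)[OF a(1)]])
      show "f b \<le> f (U a n) + \<alpha>" if "b \<in> A" for b
        using near_max[OF that] near_max[OF mem(2)[OF a(1), of n]] sum slice(1) by linarith
    qed
    moreover have "dist x (V a n) \<le> \<epsilon> / 3"
    proof (rule slice(2)[OF mem(2)[OF a(1)]])
      show "f b \<le> f (V a n) + \<alpha>" if "b \<in> A" for b
        using near_max[OF that] near_max[OF mem(1)[OF a(1), of n]] sum slice(1) by linarith
    qed
    ultimately have "norm (U a n - V a n) \<le> 2 * \<epsilon> / 3"
      using dist_triangle[of "U a n" "V a n" x] by (simp add: dist_norm norm_minus_commute)
    with uv \<epsilon>(1) show False by simp
  qed
qed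

section \<open>Dual pairs\<close>

text \<open>For dual pairs this is uniform smoothness of the left factor, and it follows from
  uniform convexity of the right one. Reversing the arguments of \<open>p\<close> gives the property
  for the other factor.\<close>

definition pairing_uniformly_smooth :: "('a::real_normed_vector \<Rightarrow> 'b::real_normed_vector \<Rightarrow> real) \<Rightarrow> bool" where
  "pairing_uniformly_smooth p \<longleftrightarrow> (\<forall>\<epsilon>>0. \<exists>\<delta>>0. \<forall>x y z. norm x \<le> 1 \<longrightarrow> norm y \<le> 1 \<longrightarrow> norm z \<le> 1 \<longrightarrow>
    p x y > 1 - \<delta> \<longrightarrow> p x z > 1 - \<delta> \<longrightarrow> norm (y - z) \<le> \<epsilon>)"

text \<open>An isometric identification of \<open>'b\<close> with the real dual of
  \<open>'a\<close>: the assumptions on \<open>p\<close> give contractivity, surjectivity and the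
  lower norm bound. It covers real duals, complex duals under the real part and, after a swap, a
  reflexive space as the dual of its dual.\<close>

locale dual_pair = bounded_bilinear p
  for p :: "'a::real_normed_vector \<Rightarrow> 'b::real_normed_vector \<Rightarrow> real" +
  assumes pairing_le: "p x y \<le> norm x * norm y"
    and represent: "\<exists>y. \<forall>x. blinfun_apply F x = p x y"
    and norm_le: "c \<ge> 0 \<Longrightarrow> (\<And>x. norm x \<le> 1 \<Longrightarrow> p x y \<le> c) \<Longrightarrow> norm y \<le> c"
begin

lemma eq_if_pairing_eq:
  assumes "\<And>x. p x y = p x z"
  shows "y = z"
proof -
  have "norm (y - z) \<le> 0" by (rule norm_le) (simp_all add: diff_right assms)
  then show ?thesis by simp
qed

lemma pairing_le_one: "norm x \<le> 1 \<Longrightarrow> norm y \<le> c \<Longrightarrow> p x y \<le> c"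
  using pairing_le[of x y] mult_mono[of "norm x" 1 "norm y" c] by simp

definition functional :: "'b \<Rightarrow> 'a \<Rightarrow>\<^sub>L real" where
  "functional y = Blinfun (\<lambda>x. p x y)"

lemma functional_apply [simp]: "functional y x = p x y"
  by (simp add: functional_def bounded_linear_Blinfun_apply bounded_linear_left)

lemma norm_functional: "norm (functional y) = norm y"
proof (rule antisym)
  show "norm (functional y) \<le> norm y"
    by (rule blinfun_norm_le) (simp_all add: pairing_le_one)
  show "norm y \<le> norm (functional y)"
    by (rule norm_le) (use blinfun_le[of "functional y" _ _ 1, OF order_refl] in simp_all)
qed

definition representer :: "('a \<Rightarrow>\<^sub>L real) \<Rightarrow> 'b" where
  "representer f = (SOME y. \<forall>x. f x = p x y)"

lemma pairing_representer [simp]: "p x (representer f) = f x"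
proof -
  have "\<forall>x. f x = p x (representer f)"
    unfolding representer_def by (rule someI_ex[OF represent])
  then show ?thesis by simp
qed

lemma representer_functional: "representer (functional y) = y"
  by (rule eq_if_pairing_eq) simp

lemma functional_representer: "functional (representer f) = f"
  by (rule blinfun_eqI) simp

lemma norm_representer: "norm (representer f) = norm f"
  using norm_functional[of "representer f"] by (simp add: functional_representer)

lemma norming_element:
  obtains y where "norm y \<le> 1" "p x y = norm x"
proof -
  obtain f :: "'a \<Rightarrow>\<^sub>L real" where "norm f \<le> 1" "f x = norm x" by (rule norming_functional)
  then show ?thesis by (intro that[of "representer f"]) (simp_all add: norm_representer)
qed

text \<open>A functional on \<open>'b\<close>, composed with \<open>representer\<close>, lies in the
  bidual of \<open>'a\<close>; reflexivity represents it by a point.\<close>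

lemma dual_pair_swap:
  assumes "reflexive_space TYPE('a)"
  shows "dual_pair (\<lambda>y x. p x y)"
proof (rule dual_pair.intro[OF flip], unfold_locales)
  show "p x y \<le> norm y * norm x" for x y using pairing_le[of x y] by (simp add: mult.commute)
  show "\<exists>x. \<forall>y. blinfun_apply F y = p x y" for F :: "'b \<Rightarrow>\<^sub>L real"
  proof -
    have "linear (\<lambda>f. F (representer f))"
    proof (rule linearI)
      have "representer (f + g) = representer f + representer g" for f g
        by (rule eq_if_pairing_eq) (simp add: blinfun.add_left add_right)
      then show "F (representer (f + g)) = F (representer f) + F (representer g)" for f g
        by (simp add: blinfun.add_right)
      have "representer (c *\<^sub>R f) = c *\<^sub>R representer f" for c f
        by (rule eq_if_pairing_eq) (simp add: blinfun.scaleR_left scaleR_right)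
      then show "F (representer (c *\<^sub>R f)) = c *\<^sub>R F (representer f)" for c f
        by (simp add: blinfun.scaleR_right)
    qed
    moreover have "F (representer f) \<le> norm F * norm f" for f
      by (rule blinfun_le) (simp_all add: norm_representer)
    ultimately obtain F' :: "('a \<Rightarrow>\<^sub>L real) \<Rightarrow>\<^sub>L real" where F': "blinfun_apply F' = (\<lambda>f. F (representer f))"
      using blinfun_of_linear[of "\<lambda>f. F (representer f)" "norm F"] by auto
    obtain x where x: "\<forall>f. F' f = blinfun_apply f x"
      using assms unfolding reflexive_space_def by blast
    have "F y = p x y" for y
      using spec[OF x, of "functional y"] by (simp add: F' representer_functional)
    then show ?thesis by blast
  qed
  show "norm x \<le> c" if "\<And>y. norm y \<le> 1 \<Longrightarrow> p x y \<le> c" for x c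
  proof -
    obtain y where "norm y \<le> 1" "p x y = norm x" by (rule norming_element)
    with that[of y] show ?thesis by simp
  qed
qed

lemma pairing_smooth_if_left_smooth:
  assumes "uniformly_smooth TYPE('a)"
  shows "pairing_uniformly_smooth p"
  unfolding pairing_uniformly_smooth_def
proof (intro allI impI)
  fix \<epsilon> :: real assume "\<epsilon> > 0"
  then obtain \<delta> where \<delta>: "\<delta> > 0" "\<forall>(f :: 'a \<Rightarrow>\<^sub>L real) (g :: 'a \<Rightarrow>\<^sub>L real) x. norm f \<le> 1 \<longrightarrow> norm g \<le> 1 \<longrightarrow> norm x \<le> 1 \<longrightarrow>
      blinfun_apply f x > 1 - \<delta> \<longrightarrow> blinfun_apply g x > 1 - \<delta> \<longrightarrow> norm (f - g) \<le> \<epsilon>"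
    using assms unfolding uniformly_smooth_def by meson
  have diff: "functional y - functional z = functional (y - z)" for y z
    by (rule blinfun_eqI) (simp add: blinfun.diff_left diff_right)
  show "\<exists>\<delta>>0. \<forall>x y z. norm x \<le> 1 \<longrightarrow> norm y \<le> 1 \<longrightarrow> norm z \<le> 1 \<longrightarrow>
      p x y > 1 - \<delta> \<longrightarrow> p x z > 1 - \<delta> \<longrightarrow> norm (y - z) \<le> \<epsilon>"
  proof (intro exI[of _ \<delta>] conjI \<delta>(1) allI impI)
    fix x y z assume "norm x \<le> 1" "norm y \<le> 1" "norm z \<le> 1" "p x y > 1 - \<delta>" "p x z > 1 - \<delta>"
    then have "norm (functional y - functional z) \<le> \<epsilon>"
      using \<delta>(2)[rule_format, of "functional y" "functional z" x] by (simp add: norm_functional)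
    then show "norm (y - z) \<le> \<epsilon>" unfolding diff norm_functional .
  qed
qed

lemma left_smooth_if_pairing_smooth:
  assumes "pairing_uniformly_smooth p"
  shows "uniformly_smooth TYPE('a)"
  unfolding uniformly_smooth_def
proof (intro allI impI)
  fix \<epsilon> :: real assume "\<epsilon> > 0"
  then obtain \<delta> where \<delta>: "\<delta> > 0" "\<forall>x y z. norm x \<le> 1 \<longrightarrow> norm y \<le> 1 \<longrightarrow> norm z \<le> 1 \<longrightarrow>
      p x y > 1 - \<delta> \<longrightarrow> p x z > 1 - \<delta> \<longrightarrow> norm (y - z) \<le> \<epsilon>"
    using assms unfolding pairing_uniformly_smooth_def by blast
  have diff: "representer f - representer g = representer (f - g)" for f g
    by (rule eq_if_pairing_eq) (simp add: blinfun.diff_left diff_right)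
  show "\<exists>\<delta>>0. \<forall>(f :: 'a \<Rightarrow>\<^sub>L real) (g :: 'a \<Rightarrow>\<^sub>L real) x. norm f \<le> 1 \<longrightarrow> norm g \<le> 1 \<longrightarrow> norm x \<le> 1 \<longrightarrow>
      blinfun_apply f x > 1 - \<delta> \<longrightarrow> blinfun_apply g x > 1 - \<delta> \<longrightarrow> norm (f - g) \<le> \<epsilon>"
  proof (intro exI[of _ \<delta>] conjI \<delta>(1) allI impI)
    fix f g :: "'a \<Rightarrow>\<^sub>L real" and x
    assume "norm f \<le> 1" "norm g \<le> 1" "norm x \<le> 1" "f x > 1 - \<delta>" "g x > 1 - \<delta>"
    then have "norm (representer f - representer g) \<le> \<epsilon>"
      using \<delta>(2)[rule_format, of x "representer f" "representer g"] by (simp add: norm_representer)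
    then show "norm (f - g) \<le> \<epsilon>" unfolding diff norm_representer .
  qed
qed

text \<open>\<open>norm (y + z)\<close> is at least \<open>p x (y + z)\<close>, hence close to
  2.\<close>

lemma pairing_smooth_if_right_convex:
  assumes "uniformly_convex TYPE('b)"
  shows "pairing_uniformly_smooth p"
  unfolding pairing_uniformly_smooth_def
proof (intro allI impI)
  fix \<epsilon> :: real assume "\<epsilon> > 0"
  then obtain \<delta> where \<delta>: "\<delta> > 0"
      "\<forall>(x :: 'b) y. norm x \<le> 1 \<longrightarrow> norm y \<le> 1 \<longrightarrow> norm (x + y) > 2 - \<delta> \<longrightarrow> norm (x - y) \<le> \<epsilon>"
    using assms unfolding uniformly_convex_def by meson
  show "\<exists>\<delta>>0. \<forall>x y z. norm x \<le> 1 \<longrightarrow> norm y \<le> 1 \<longrightarrow> norm z \<le> 1 \<longrightarrow>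
      p x y > 1 - \<delta> \<longrightarrow> p x z > 1 - \<delta> \<longrightarrow> norm (y - z) \<le> \<epsilon>"
  proof (intro exI[of _ "\<delta> / 2"] conjI allI impI)
    fix x y z assume *: "norm x \<le> 1" "norm y \<le> 1" "norm z \<le> 1" "p x y > 1 - \<delta> / 2" "p x z > 1 - \<delta> / 2"
    have "p x (y + z) \<le> norm (y + z)" by (rule pairing_le_one) (use * in simp_all)
    then have "norm (y + z) > 2 - \<delta>" using * by (simp add: add_right)
    then show "norm (y - z) \<le> \<epsilon>" by (rule \<delta>(2)[rule_format, OF *(2,3)])
  qed (use \<delta>(1) in simp)
qed

section \<open>Adjoints with respect to a pairing\<close>

definition adjoint :: "('a \<Rightarrow>\<^sub>L 'a) \<Rightarrow> 'b \<Rightarrow>\<^sub>L 'b" where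
  "adjoint T = Blinfun (\<lambda>y. representer (functional y o\<^sub>L T))"

lemma norm_representer_compose: "norm (representer (functional y o\<^sub>L T)) \<le> norm T * norm y"
  using norm_blinfun_compose[of "functional y" T]
  by (simp add: norm_representer norm_functional mult.commute)

lemma pairing_adjoint: "p x (adjoint T y) = p (T x) y"
proof -
  have "bounded_linear (\<lambda>y. representer (functional y o\<^sub>L T))"
  proof (rule bounded_linear_intro[of _ "norm T"])
    show "representer (functional (y + z) o\<^sub>L T) = representer (functional y o\<^sub>L T) + representer (functional z o\<^sub>L T)" for y z
      by (rule eq_if_pairing_eq) (simp add: add_right)
    show "representer (functional (c *\<^sub>R y) o\<^sub>L T) = c *\<^sub>R representer (functional y o\<^sub>L T)" for c y
      by (rule eq_if_pairing_eq) (simp add: scaleR_right)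
    show "norm (representer (functional y o\<^sub>L T)) \<le> norm y * norm T" for y
      using norm_representer_compose[of y T] by (simp add: mult.commute)
  qed
  then show ?thesis by (simp add: adjoint_def bounded_linear_Blinfun_apply)
qed

text \<open>Phrased for differences so that \<open>R = 0\<close> gives the norm bound and
  \<open>R = id_blinfun\<close> gives closeness to the identity.\<close>

lemma norm_adjoint_diff_le: "norm (adjoint T - adjoint R) \<le> norm (T - R)"
proof (rule norm_blinfun_bound)
  fix y
  show "norm ((adjoint T - adjoint R) y) \<le> norm (T - R) * norm y"
  proof (rule norm_le)
    fix x :: 'a assume "norm x \<le> 1"
    have "p x ((adjoint T - adjoint R) y) = p ((T - R) x) y"
      by (simp add: blinfun.diff_left diff_right diff_left pairing_adjoint)
    also have "\<dots> \<le> norm ((T - R) x) * norm y" by (rule pairing_le)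
    also have "\<dots> \<le> norm (T - R) * norm y"
      using norm_blinfun[of "T - R" x] \<open>norm x \<le> 1\<close> mult_left_mono[of "norm x" 1 "norm (T - R)"]
      by (intro mult_right_mono) auto
    finally show "p x ((adjoint T - adjoint R) y) \<le> norm (T - R) * norm y" .
  qed simp
qed simp

lemma adjoint_id: "adjoint id_blinfun = id_blinfun"
  by (rule blinfun_eqI, rule eq_if_pairing_eq) (simp add: pairing_adjoint)

lemma norm_adjoint_le: "norm (adjoint T) \<le> norm T"
proof -
  have "adjoint 0 = 0"
    by (rule blinfun_eqI, rule eq_if_pairing_eq) (simp add: pairing_adjoint zero_left zero_right)
  then show ?thesis using norm_adjoint_diff_le[of T 0] by simp
qed

text \<open>Let \<open>u\<close> norm \<open>y\<close> and \<open>v\<close> norm \<open>z\<close>.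
  If \<open>T v = u\<close>, then \<open>p v (adjoint T y) = p u y = 1\<close>, so
  \<open>adjoint T y\<close> and \<open>z\<close> both have pairing 1 with \<open>v\<close> and
  coincide by smoothness.\<close>

lemma uniformly_micro_adjoint:
  assumes swap: "dual_pair (\<lambda>y x. p x y)"
    and smooth: "pairing_uniformly_smooth p" "pairing_uniformly_smooth (\<lambda>y x. p x y)"
    and G: "uniformly_micro G" "\<forall>T\<in>G. norm T \<le> 1" and H: "\<And>T. T \<in> G \<Longrightarrow> adjoint T \<in> H"
  shows "uniformly_micro H"
  unfolding uniformly_micro_def
proof (intro allI impI)
  fix \<epsilon> :: real assume "\<epsilon> > 0"
  interpret swap: dual_pair "\<lambda>y x. p x y" by (rule swap)
  obtain \<delta> where \<delta>: "\<delta> > 0" "\<forall>x y. norm x = 1 \<longrightarrow> norm y = 1 \<longrightarrow> norm (x - y) < \<delta> \<longrightarrow>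
      (\<exists>T\<in>G. blinfun_apply T x = y \<and> norm (T - id_blinfun) < \<epsilon>)"
    using G(1) \<open>\<epsilon> > 0\<close> unfolding uniformly_micro_def by meson
  \<comment> \<open>Half of \<delta>, because smoothness yields a weak inequality and the choice of
    \<open>T\<close> needs a strict one.\<close>
  have "\<delta> / 2 > 0" using \<delta>(1) by simp
  then obtain \<eta> where \<eta>: "\<eta> > 0" "\<forall>y x z. norm y \<le> 1 \<longrightarrow> norm x \<le> 1 \<longrightarrow> norm z \<le> 1 \<longrightarrow>
      p x y > 1 - \<eta> \<longrightarrow> p z y > 1 - \<eta> \<longrightarrow> norm (x - z) \<le> \<delta> / 2"
    using smooth(2) unfolding pairing_uniformly_smooth_def by blast
  \<comment> \<open>Uniqueness of norming partners: smoothness bounds their distance by half of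
    itself.\<close>
  have same: "y = z" if "norm x = 1" "norm y \<le> 1" "norm z \<le> 1" "p x y = 1" "p x z = 1" for x y z
  proof (rule ccontr)
    assume "y \<noteq> z"
    then have "norm (y - z) / 2 > 0" by simp
    then obtain d where d: "d > 0" "\<forall>x y' z'. norm x \<le> 1 \<longrightarrow> norm y' \<le> 1 \<longrightarrow> norm z' \<le> 1 \<longrightarrow>
        p x y' > 1 - d \<longrightarrow> p x z' > 1 - d \<longrightarrow> norm (y' - z') \<le> norm (y - z) / 2"
      using smooth(1) unfolding pairing_uniformly_smooth_def by blast
    have "norm (y - z) \<le> norm (y - z) / 2"
      using d(1) that by (intro d(2)[rule_format, of x y z]) simp_all
    with \<open>y \<noteq> z\<close> show False by simp
  qed
  show "\<exists>\<delta>>0. \<forall>x y. norm x = 1 \<longrightarrow> norm y = 1 \<longrightarrow> norm (x - y) < \<delta> \<longrightarrow>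
      (\<exists>T\<in>H. blinfun_apply T x = y \<and> norm (T - id_blinfun) < \<epsilon>)"
  proof (intro exI[of _ \<eta>] conjI \<eta>(1) allI impI)
    fix y z :: 'b assume y: "norm y = 1" and z: "norm z = 1" and yz: "norm (y - z) < \<eta>"
    have attain: "\<exists>x. norm x = 1 \<and> p x w = 1" if "norm w = 1" for w
    proof -
      obtain x where "norm x \<le> 1" "p x w = norm w" using swap.norming_element by metis
      with that pairing_le[of x w] show ?thesis by auto
    qed
    obtain u where u: "norm u = 1" "p u y = 1" using attain[OF y] by blast
    obtain v where v: "norm v = 1" "p v z = 1" using attain[OF z] by blast
    \<comment> \<open>\<open>v\<close> norms \<open>z\<close> and hence almost norms the nearby
      \<open>y\<close>, which \<open>u\<close> norms exactly; so \<open>u\<close> and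
      \<open>v\<close> are close.\<close>
    have "p v (z - y) \<le> norm (z - y)" by (rule pairing_le_one) (use v in simp_all)
    then have "p v y > 1 - \<eta>" using v yz by (simp add: diff_right norm_minus_commute)
    then have "norm (v - u) \<le> \<delta> / 2"
      using \<eta>(1) u v y by (intro \<eta>(2)[rule_format, of y v u]) simp_all
    then obtain T where T: "T \<in> G" "T v = u" "norm (T - id_blinfun) < \<epsilon>"
      using \<delta> u(1) v(1) by force
    show "\<exists>S\<in>H. blinfun_apply S y = z \<and> norm (S - id_blinfun) < \<epsilon>"
    proof (intro bexI[OF _ H[OF T(1)]] conjI)
      have "norm (adjoint T) \<le> 1" using norm_adjoint_le[of T] bspec[OF G(2) T(1)] by simp
      then have "norm (adjoint T y) \<le> 1" using norm_blinfun[of "adjoint T" y] y by simp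
      then show "adjoint T y = z"
        by (intro same[OF v(1)]) (simp_all add: pairing_adjoint T(2) u v z)
      show "norm (adjoint T - id_blinfun) < \<epsilon>"
        using norm_adjoint_diff_le[of T id_blinfun] T(3) by (simp add: adjoint_id)
    qed
  qed
qed

end

section \<open>Semitransitivity in terms of contractions\<close>

lemma bounded_operators_iff:
  assumes "vector_space s"
  shows "T \<in> bounded_operators s \<longleftrightarrow> (\<forall>c x. blinfun_apply T (s c x) = s c (blinfun_apply T x))"
  using assms
  by (simp add: bounded_operators_def Vector_Spaces.linear_iff blinfun.add_right)

text \<open>The bound \<open>\<le> 1\<close> passes to adjoints directly; an operator in this set
  taking one unit vector to another has norm exactly 1.\<close>

definition contractions :: "('k::field \<Rightarrow> 'a \<Rightarrow> 'a) \<Rightarrow> ('a::real_normed_vector \<Rightarrow>\<^sub>L 'a) set" where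
  "contractions s = {T \<in> bounded_operators s. norm T \<le> 1}"

lemma uniformly_micro_semitransitive_iff:
  fixes s :: "'k::field \<Rightarrow> 'a \<Rightarrow> 'a::real_normed_vector"
  shows "uniformly_micro_semitransitive s \<longleftrightarrow> uniformly_micro (contractions s)"
proof
  assume "uniformly_micro_semitransitive s"
  then obtain \<beta> where \<beta>: "\<And>\<epsilon>. \<epsilon> \<in> {0<..<2} \<Longrightarrow> \<beta> \<epsilon> > (0::real)"
    "\<And>\<epsilon> x y. \<epsilon> \<in> {0<..<2} \<Longrightarrow> x \<in> sphere 0 1 \<Longrightarrow> y \<in> sphere 0 1 \<Longrightarrow> norm (x - y) < \<beta> \<epsilon> \<Longrightarrow>
        \<exists>T \<in> bounded_operators s. norm T = 1 \<and> blinfun_apply T x = y \<and> norm (T - id_blinfun) < \<epsilon>"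
    unfolding uniformly_micro_semitransitive_def by blast
  show "uniformly_micro (contractions s)"
    unfolding uniformly_micro_def
  proof (intro allI impI)
    fix \<epsilon> :: real assume "\<epsilon> > 0"
    \<comment> \<open>Values of \<epsilon> from 2 on are outside the range that \<beta>
      controls.\<close>
    define \<epsilon>' where "\<epsilon>' = min \<epsilon> 1"
    have \<epsilon>': "\<epsilon>' \<in> {0<..<2}" "\<epsilon>' \<le> \<epsilon>" using \<open>\<epsilon> > 0\<close> by (auto simp: \<epsilon>'_def)
    show "\<exists>\<delta>>0. \<forall>x y. norm x = 1 \<longrightarrow> norm y = 1 \<longrightarrow> norm (x - y) < \<delta> \<longrightarrow>
        (\<exists>T\<in>contractions s. blinfun_apply T x = y \<and> norm (T - id_blinfun) < \<epsilon>)"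
    proof (intro exI[of _ "\<beta> \<epsilon>'"] conjI \<beta>(1)[OF \<epsilon>'(1)] allI impI)
      fix x y :: 'a assume "norm x = 1" "norm y = 1" "norm (x - y) < \<beta> \<epsilon>'"
      then obtain T where "T \<in> bounded_operators s" "norm T = 1" "blinfun_apply T x = y" "norm (T - id_blinfun) < \<epsilon>'"
        using \<beta>(2)[OF \<epsilon>'(1), of x y] by auto
      then show "\<exists>T\<in>contractions s. blinfun_apply T x = y \<and> norm (T - id_blinfun) < \<epsilon>"
        using \<epsilon>'(2) by (intro bexI[of _ T]) (auto simp: contractions_def)
    qed
  qed
next
  assume "uniformly_micro (contractions s)"
  then obtain \<beta> where \<beta>: "\<And>\<epsilon>. \<epsilon> > (0::real) \<Longrightarrow> \<beta> \<epsilon> > (0::real)"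
    "\<And>\<epsilon> x y. \<epsilon> > 0 \<Longrightarrow> norm x = 1 \<Longrightarrow> norm y = 1 \<Longrightarrow> norm (x - y) < \<beta> \<epsilon> \<Longrightarrow>
        \<exists>T \<in> contractions s. blinfun_apply T x = y \<and> norm (T - id_blinfun) < \<epsilon>"
    unfolding uniformly_micro_def by metis
  show "uniformly_micro_semitransitive s"
    unfolding uniformly_micro_semitransitive_def
  proof (intro exI[of _ \<beta>] conjI ballI impI)
    fix \<epsilon> :: real and x y :: 'a assume "\<epsilon> \<in> {0<..<2}" and xy: "x \<in> sphere 0 1" "y \<in> sphere 0 1" "norm (x - y) < \<beta> \<epsilon>"
    then obtain T where T: "T \<in> contractions s" "blinfun_apply T x = y" "norm (T - id_blinfun) < \<epsilon>"
      using \<beta>(2)[of \<epsilon> x y] by auto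
    have "1 \<le> norm T" using norm_blinfun[of T x] T(2) xy by simp
    with T show "\<exists>T\<in>bounded_operators s. norm T = 1 \<and> blinfun_apply T x = y \<and> norm (T - id_blinfun) < \<epsilon>"
      by (intro bexI[of _ T]) (auto simp: contractions_def)
  qed (use \<beta>(1) in auto)
qed

section \<open>Micro-transitivity\<close>

lemma surjective_isometries_iff:
  assumes "vector_space s"
  shows "T \<in> surjective_isometries s \<longleftrightarrow> (\<forall>c x. blinfun_apply T (s c x) = s c (blinfun_apply T x)) \<and>
    surj (blinfun_apply T) \<and> (\<forall>x. norm (blinfun_apply T x) = norm x)"
  by (simp add: surjective_isometries_def bounded_operators_iff[OF assms])

lemma surjective_isometries_norm_le: "T \<in> surjective_isometries s \<Longrightarrow> norm T \<le> 1"
  by (rule norm_blinfun_bound) (simp_all add: surjective_isometries_def)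

lemma surjective_isometries_compose:
  assumes "vector_space s" "T \<in> surjective_isometries s" "R \<in> surjective_isometries s"
  shows "T o\<^sub>L R \<in> surjective_isometries s"
proof -
  note T = assms(2)[unfolded surjective_isometries_iff[OF assms(1)]]
  note R = assms(3)[unfolded surjective_isometries_iff[OF assms(1)]]
  have "surj (blinfun_apply T \<circ> blinfun_apply R)" using T R by (intro comp_surj) auto
  then have "surj (blinfun_apply (T o\<^sub>L R))" by (simp add: comp_def)
  then show ?thesis using T R unfolding surjective_isometries_iff[OF assms(1)] by simp
qed

lemma surjective_isometries_inverse:
  assumes s: "vector_space s" and T: "T \<in> surjective_isometries s"
  obtains R where "R \<in> surjective_isometries s"
    "\<And>x. blinfun_apply R (blinfun_apply T x) = x" "\<And>x. blinfun_apply T (blinfun_apply R x) = x"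
proof -
  have scale: "blinfun_apply T (s c x) = s c (blinfun_apply T x)"
    and surj: "surj (blinfun_apply T)" and iso: "norm (blinfun_apply T x) = norm x" for c x
    using T unfolding surjective_isometries_iff[OF s] by blast+
  have "inj (blinfun_apply T)"
  proof (rule injI)
    fix x y assume "blinfun_apply T x = blinfun_apply T y"
    then have "norm (blinfun_apply T (x - y)) = 0" by (simp add: blinfun.diff_right)
    then show "x = y" by (simp add: iso)
  qed
  define r where "r = inv (blinfun_apply T)"
  have rT: "r (blinfun_apply T x) = x" for x
    unfolding r_def by (rule inv_f_f[OF \<open>inj (blinfun_apply T)\<close>])
  have Tr: "blinfun_apply T (r x) = x" for x
    unfolding r_def by (rule surj_f_inv_f[OF surj])
  have norm_r: "norm (r x) = norm x" for x using iso[of "r x"] by (simp only: Tr)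
  have "bounded_linear r"
  proof (rule bounded_linear_intro[of _ 1])
    show "r (x + y) = r x + r y" for x y
      using rT[of "r x + r y"] by (simp only: blinfun.add_right Tr)
    show "r (c *\<^sub>R x) = c *\<^sub>R r x" for c x
      using rT[of "c *\<^sub>R r x"] by (simp only: blinfun.scaleR_right Tr)
    show "norm (r x) \<le> norm x * 1" for x by (simp add: norm_r)
  qed
  then have R: "blinfun_apply (Blinfun r) = r" by (rule bounded_linear_Blinfun_apply)
  have "r (s c x) = s c (r x)" for c x using rT[of "s c (r x)"] by (simp only: scale Tr)
  moreover have "surj r" using rT by (rule surjI)
  ultimately have "Blinfun r \<in> surjective_isometries s"
    unfolding surjective_isometries_iff[OF s] R using norm_r by blast
  then show ?thesis by (rule that) (simp_all only: R rT Tr)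
qed

lemma id_surjective_isometry:
  "vector_space s \<Longrightarrow> id_blinfun \<in> surjective_isometries s"
  by (simp add: surjective_isometries_iff)

lemma minus_id_surjective_isometry:
  fixes s :: "'k::field \<Rightarrow> 'a \<Rightarrow> 'a::real_normed_vector"
  assumes "vector_space s"
  shows "- id_blinfun \<in> surjective_isometries s"
proof -
  interpret vector_space s by fact
  have "surj (\<lambda>x :: 'a. - x)" by (rule surjI[of _ uminus]) simp
  then show ?thesis by (simp add: surjective_isometries_iff[OF assms] blinfun.minus_left)
qed

text \<open>The normalised segment: it could meet the origin only at its midpoint, and there only if
  \<open>y = - x\<close>.\<close>

lemma nonantipodal_arc:
  fixes x y :: "'a::real_normed_vector"
  assumes x: "norm x = 1" and y: "norm y = 1" and ne: "y \<noteq> - x"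
  obtains C where "connected C" "x \<in> C" "y \<in> C" "C \<subseteq> sphere 0 1"
proof
  define z where "z t = (1 - t) *\<^sub>R x + t *\<^sub>R y" for t :: real
  have nz: "z t \<noteq> 0" if "t \<in> {0..1}" for t
  proof
    assume "z t = 0"
    then have eq: "t *\<^sub>R y = - ((1 - t) *\<^sub>R x)" unfolding z_def by (simp add: add_eq_0_iff)
    then have "norm (t *\<^sub>R y) = norm ((1 - t) *\<^sub>R x)" by simp
    then have "t = 1/2" using that x y by simp
    with eq have "(1/2) *\<^sub>R y = (1/2) *\<^sub>R (- x)" by simp
    then show False using ne by (simp only: scaleR_cancel_left) simp
  qed
  let ?C = "(\<lambda>t. sgn (z t)) ` {0..1}"
  have "continuous_on {0..1} (\<lambda>t. sgn (z t))"
    unfolding z_def[abs_def] sgn_div_norm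
    by (intro continuous_intros) (use nz in \<open>auto simp: z_def\<close>)
  then show "connected ?C" by (rule connected_continuous_image) simp
  show "x \<in> ?C" by (rule image_eqI[of _ _ 0]) (simp_all add: z_def sgn_div_norm x)
  show "y \<in> ?C" by (rule image_eqI[of _ _ 1]) (simp_all add: z_def sgn_div_norm y)
  show "?C \<subseteq> sphere 0 1" using nz by (auto simp: norm_sgn)
qed

lemma neighbourhood_in_sphere_iff:
  fixes x :: "'a::real_normed_vector"
  assumes "norm x = 1"
  shows "neighbourhood_in (top_of_set (sphere 0 1)) x U \<longleftrightarrow>
    U \<subseteq> sphere 0 1 \<and> (\<exists>\<delta>>0. \<forall>y. norm y = 1 \<longrightarrow> norm (x - y) < \<delta> \<longrightarrow> y \<in> U)"
proof (intro iffI conjI)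
  assume *: "neighbourhood_in (top_of_set (sphere 0 1)) x U"
  then show "U \<subseteq> sphere 0 1" by (simp add: neighbourhood_in_def)
  from * obtain W where "openin (top_of_set (sphere 0 1)) W" "x \<in> W" "W \<subseteq> U"
    by (auto simp: neighbourhood_in_def)
  then obtain \<delta> where "\<delta> > 0" "ball x \<delta> \<inter> sphere 0 1 \<subseteq> U"
    unfolding openin_contains_ball by blast
  then show "\<exists>\<delta>>0. \<forall>y. norm y = 1 \<longrightarrow> norm (x - y) < \<delta> \<longrightarrow> y \<in> U"
    by (intro exI[of _ \<delta>]) (auto simp: dist_norm)
next
  assume *: "U \<subseteq> sphere 0 1 \<and> (\<exists>\<delta>>0. \<forall>y. norm y = 1 \<longrightarrow> norm (x - y) < \<delta> \<longrightarrow> y \<in> U)"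
  then obtain \<delta> where "\<delta> > 0" "\<forall>y. norm y = 1 \<longrightarrow> norm (x - y) < \<delta> \<longrightarrow> y \<in> U" by blast
  then have "x \<in> sphere 0 1 \<inter> ball x \<delta>" "sphere 0 1 \<inter> ball x \<delta> \<subseteq> U"
    using assms by (auto simp: dist_norm)
  with * show "neighbourhood_in (top_of_set (sphere 0 1)) x U"
    unfolding neighbourhood_in_def
    by (intro conjI exI[of _ "sphere 0 1 \<inter> ball x \<delta>"] openin_open_Int[OF open_ball]) simp_all
qed

lemma micro_transitive_imp_orbit_nhd:
  assumes mt: "micro_transitive s" and s: "vector_space s" and x: "norm x = 1" and "\<epsilon> > 0"
  shows "\<exists>\<delta>>0. \<forall>y. norm y = 1 \<longrightarrow> norm (x - y) < \<delta> \<longrightarrow>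
    (\<exists>T\<in>surjective_isometries s. blinfun_apply T x = y \<and> norm (T - id_blinfun) < \<epsilon>)"
proof -
  let ?G = "surjective_isometries s"
  let ?U = "?G \<inter> ball id_blinfun \<epsilon>"
  have "neighbourhood_in (top_of_set ?G) id_blinfun ?U"
    unfolding neighbourhood_in_def
    using \<open>\<epsilon> > 0\<close> id_surjective_isometry[OF s] openin_open_Int[OF open_ball, of ?G id_blinfun \<epsilon>]
    by (intro conjI exI[of _ ?U]) auto
  then have "neighbourhood_in (top_of_set (sphere 0 1)) x ((\<lambda>T. blinfun_apply T x) ` ?U)"
    using mt x unfolding micro_transitive_def by auto
  then obtain \<delta> where \<delta>: "\<delta> > 0"
      "\<forall>y. norm y = 1 \<longrightarrow> norm (x - y) < \<delta> \<longrightarrow> y \<in> (\<lambda>T. blinfun_apply T x) ` ?U"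
    unfolding neighbourhood_in_sphere_iff[OF x] by blast
  show ?thesis
  proof (intro exI[of _ \<delta>] conjI \<delta>(1) allI impI)
    fix y assume "norm y = 1" "norm (x - y) < \<delta>"
    then obtain T where "T \<in> ?U" "y = blinfun_apply T x" using \<delta>(2) by blast
    then show "\<exists>T\<in>?G. blinfun_apply T x = y \<and> norm (T - id_blinfun) < \<epsilon>"
      by (intro bexI[of _ T]) (auto simp: dist_norm norm_minus_commute)
  qed
qed

text \<open>Orbits are relatively open, so a connected arc stays in one orbit. The antipode is
  reached by \<open>- id_blinfun\<close>, which also covers the disconnected sphere of the real
  line.\<close>

lemma micro_transitive_imp_transitive:
  assumes mt: "micro_transitive s" and s: "vector_space s" and x: "norm x = 1" and y: "norm y = 1"
  shows "\<exists>T\<in>surjective_isometries s. blinfun_apply T x = y"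
proof (cases "y = - x")
  case True
  then show ?thesis
    by (intro bexI[OF _ minus_id_surjective_isometry[OF s]]) (simp add: blinfun.minus_left)
next
  case False
  let ?G = "surjective_isometries s"
  obtain C where C: "connected C" "x \<in> C" "y \<in> C" "C \<subseteq> sphere 0 1"
    using nonantipodal_arc[OF x y False] by blast
  show ?thesis
  proof (rule connected_equivalence_relation[OF C(1-3), of "\<lambda>x y. \<exists>T\<in>?G. blinfun_apply T x = y"])
    show "\<exists>T\<in>?G. blinfun_apply T b = a" if T: "\<exists>T\<in>?G. blinfun_apply T a = b" for a b
    proof -
      obtain T where T: "T \<in> ?G" "blinfun_apply T a = b" using T by blast
      obtain R where "R \<in> ?G" "\<And>x. blinfun_apply R (blinfun_apply T x) = x"
        using surjective_isometries_inverse[OF s T(1)] by metis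
      then show ?thesis using T(2) by blast
    qed
    show "\<exists>T\<in>?G. blinfun_apply T a = c"
      if abc: "\<exists>T\<in>?G. blinfun_apply T a = b" "\<exists>T\<in>?G. blinfun_apply T b = c" for a b c
    proof -
      obtain T R where "T \<in> ?G" "blinfun_apply T a = b" "R \<in> ?G" "blinfun_apply R b = c" using abc by blast
      then show ?thesis by (intro bexI[OF _ surjective_isometries_compose[OF s, of R T]]) auto
    qed
    show "\<exists>W. openin (top_of_set C) W \<and> a \<in> W \<and> (\<forall>b\<in>W. \<exists>T\<in>?G. blinfun_apply T a = b)" if "a \<in> C" for a
    proof -
      have "norm a = 1" using that C(4) by auto
      then obtain \<delta> where \<delta>: "\<delta> > 0" "\<forall>b. norm b = 1 \<longrightarrow> norm (a - b) < \<delta> \<longrightarrow>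
          (\<exists>T\<in>?G. blinfun_apply T a = b \<and> norm (T - id_blinfun) < 1)"
        using micro_transitive_imp_orbit_nhd[OF mt s _ zero_less_one] by blast
      show ?thesis
      proof (intro exI[of _ "C \<inter> ball a \<delta>"] conjI ballI)
        show "openin (top_of_set C) (C \<inter> ball a \<delta>)" by (rule openin_open_Int[OF open_ball])
        show "a \<in> C \<inter> ball a \<delta>" using that \<delta>(1) by simp
        fix b assume "b \<in> C \<inter> ball a \<delta>"
        then have "norm b = 1" "norm (a - b) < \<delta>" using C(4) by (auto simp: dist_norm)
        then show "\<exists>T\<in>?G. blinfun_apply T a = b" using \<delta>(2) by blast
      qed
    qed
  qed
qed

text \<open>The definition is pointwise; transitivity makes it uniform. The \<delta> found at one
  \<open>x0\<close> works everywhere, since conjugation by surjective isometries preserves the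
  distance to the identity.\<close>

lemma micro_transitive_iff:
  fixes s :: "'k::field \<Rightarrow> 'a \<Rightarrow> 'a::real_normed_vector"
  assumes s: "vector_space s"
  shows "micro_transitive s \<longleftrightarrow> uniformly_micro (surjective_isometries s)"
proof
  let ?G = "surjective_isometries s"
  assume mt: "micro_transitive s"
  show "uniformly_micro ?G"
    unfolding uniformly_micro_def
  proof (intro allI impI)
    fix \<epsilon> :: real assume "\<epsilon> > 0"
    show "\<exists>\<delta>>0. \<forall>x y. norm x = 1 \<longrightarrow> norm y = 1 \<longrightarrow> norm (x - y) < \<delta> \<longrightarrow>
        (\<exists>T\<in>?G. blinfun_apply T x = y \<and> norm (T - id_blinfun) < \<epsilon>)"
    proof (cases "\<exists>x0 :: 'a. norm x0 = 1")
      case False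
      then show ?thesis using zero_less_one by blast
    next
      case True
      then obtain x0 :: 'a where x0: "norm x0 = 1" by blast
      obtain \<delta> where \<delta>: "\<delta> > 0" "\<forall>y. norm y = 1 \<longrightarrow> norm (x0 - y) < \<delta> \<longrightarrow>
          (\<exists>T\<in>?G. blinfun_apply T x0 = y \<and> norm (T - id_blinfun) < \<epsilon>)"
        using micro_transitive_imp_orbit_nhd[OF mt s x0 \<open>\<epsilon> > 0\<close>] by blast
      show ?thesis
      proof (intro exI[of _ \<delta>] conjI \<delta>(1) allI impI)
        fix x y :: 'a assume x: "norm x = 1" and y: "norm y = 1" and xy: "norm (x - y) < \<delta>"
        obtain R where R: "R \<in> ?G" "R x0 = x" using micro_transitive_imp_transitive[OF mt s x0 x] by blast
        obtain R' where R': "R' \<in> ?G" "\<And>x. R' (R x) = x" "\<And>x. R (R' x) = x"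
          using surjective_isometries_inverse[OF s R(1)] by metis
        have iso: "norm (R' z) = norm z" for z using R'(1) by (simp add: surjective_isometries_def)
        have "x0 - R' y = R' (x - y)" using R(2) R'(2) by (metis blinfun.diff_right)
        then have "norm (x0 - R' y) < \<delta>" using xy iso by simp
        then obtain T where T: "T \<in> ?G" "T x0 = R' y" "norm (T - id_blinfun) < \<epsilon>"
          using \<delta>(2) iso y by metis
        show "\<exists>T\<in>?G. blinfun_apply T x = y \<and> norm (T - id_blinfun) < \<epsilon>"
        proof (intro bexI conjI)
          \<comment> \<open>The conjugate takes \<open>x\<close> to \<open>x0\<close>, then to
            \<open>R' y\<close>, then to \<open>y\<close>.\<close>
          show "R o\<^sub>L (T o\<^sub>L R') \<in> ?G"
            by (intro surjective_isometries_compose[OF s] R R' T)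
          have "R' x = x0" using R(2) R'(2) by metis
          then show "(R o\<^sub>L (T o\<^sub>L R')) x = y" by (simp add: T(2) R'(3))
          have "(R o\<^sub>L (T o\<^sub>L R')) - id_blinfun = R o\<^sub>L ((T - id_blinfun) o\<^sub>L R')"
            by (rule blinfun_eqI) (simp add: blinfun.diff_left blinfun.diff_right R'(3))
          also have "norm \<dots> \<le> norm R * (norm (T - id_blinfun) * norm R')"
            by (intro order_trans[OF norm_blinfun_compose] mult_left_mono norm_blinfun_compose) simp
          also have "\<dots> \<le> 1 * (norm (T - id_blinfun) * 1)"
            by (intro mult_mono surjective_isometries_norm_le[OF R(1)] surjective_isometries_norm_le[OF R'(1)]) simp_all
          finally show "norm ((R o\<^sub>L (T o\<^sub>L R')) - id_blinfun) < \<epsilon>" using T(3) by simp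
        qed
      qed
    qed
  qed
next
  let ?G = "surjective_isometries s"
  assume um: "uniformly_micro ?G"
  show "micro_transitive s"
    unfolding micro_transitive_def
  proof (intro ballI allI impI)
    fix x :: 'a and U
    assume "x \<in> sphere 0 1" and U: "neighbourhood_in (top_of_set ?G) id_blinfun U"
    then have x: "norm x = 1" by simp
    obtain W where "U \<subseteq> ?G" "openin (top_of_set ?G) W" "id_blinfun \<in> W" "W \<subseteq> U"
      using U by (auto simp: neighbourhood_in_def)
    then obtain \<epsilon> where \<epsilon>: "\<epsilon> > 0" "ball id_blinfun \<epsilon> \<inter> ?G \<subseteq> U"
      unfolding openin_contains_ball by blast
    obtain \<delta> where \<delta>: "\<delta> > 0" "\<forall>x y. norm x = 1 \<longrightarrow> norm y = 1 \<longrightarrow> norm (x - y) < \<delta> \<longrightarrow>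
        (\<exists>T\<in>?G. blinfun_apply T x = y \<and> norm (T - id_blinfun) < \<epsilon>)"
      using um \<epsilon>(1) unfolding uniformly_micro_def by meson
    show "neighbourhood_in (top_of_set (sphere 0 1)) x ((\<lambda>T. blinfun_apply T x) ` U)"
      unfolding neighbourhood_in_sphere_iff[OF x]
    proof (intro conjI exI[of _ \<delta>] \<delta>(1) allI impI)
      show "(\<lambda>T. blinfun_apply T x) ` U \<subseteq> sphere 0 1"
        using \<open>U \<subseteq> ?G\<close> x by (auto simp: surjective_isometries_def)
      fix y assume "norm y = 1" "norm (x - y) < \<delta>"
      then obtain T where T: "T \<in> ?G" "blinfun_apply T x = y" "norm (T - id_blinfun) < \<epsilon>"
        using \<delta>(2) x by blast
      then have "T \<in> ball id_blinfun \<epsilon> \<inter> ?G" by (simp add: dist_norm norm_minus_commute)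
      then show "y \<in> (\<lambda>T. blinfun_apply T x) ` U" using \<epsilon>(2) T(2) by blast
    qed
  qed
qed

text \<open>The pairing stays real-valued even for complex scalars, and scalars pass across it
  without conjugation, so adjoints are linear over \<open>'k\<close>.\<close>

locale scalar_dual_pair = dual_pair p
  for p :: "'a::real_normed_vector \<Rightarrow> 'b::real_normed_vector \<Rightarrow> real" +
  fixes s :: "'k::field \<Rightarrow> 'a \<Rightarrow> 'a" and t :: "'k \<Rightarrow> 'b \<Rightarrow> 'b"
  assumes left_space: "vector_space s" and right_space: "vector_space t"
    and pairing_scale: "p (s c x) y = p x (t c y)"
begin

lemma adjoint_bounded_operators:
  assumes "T \<in> bounded_operators s"
  shows "adjoint T \<in> bounded_operators t"
  using assms unfolding bounded_operators_iff[OF left_space] bounded_operators_iff[OF right_space]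
  by (intro allI eq_if_pairing_eq) (simp add: pairing_adjoint pairing_scale[symmetric])

lemma adjoint_contractions: "T \<in> contractions s \<Longrightarrow> adjoint T \<in> contractions t"
  using adjoint_bounded_operators norm_adjoint_le[of T] by (simp add: contractions_def)

text \<open>The adjoint of the inverse inverts the adjoint, and two mutually inverse contractions
  are isometries.\<close>

lemma adjoint_surjective_isometries:
  assumes T: "T \<in> surjective_isometries s"
  shows "adjoint T \<in> surjective_isometries t"
proof -
  obtain R where R: "R \<in> surjective_isometries s"
      "\<And>x. R (T x) = x" "\<And>x. T (R x) = x"
    using surjective_isometries_inverse[OF left_space T] by metis
  have TR: "adjoint T (adjoint R y) = y" for y
    by (rule eq_if_pairing_eq) (simp add: pairing_adjoint R)
  have RT: "adjoint R (adjoint T y) = y" for y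
    by (rule eq_if_pairing_eq) (simp add: pairing_adjoint R)
  have le: "norm (adjoint S y) \<le> norm y" if "S \<in> surjective_isometries s" for S y
  proof -
    have "norm (adjoint S) \<le> 1"
      using norm_adjoint_le surjective_isometries_norm_le[OF that] by (rule order_trans)
    then show ?thesis
      using norm_blinfun[of "adjoint S" y] mult_right_mono[of "norm (adjoint S)" 1 "norm y"] by simp
  qed
  have "norm (adjoint T y) = norm y" for y
    using le[OF T, of y] le[OF R(1), of "adjoint T y"] by (simp add: RT)
  moreover have "surj (adjoint T)" using TR by (rule surjI)
  moreover have "adjoint T \<in> bounded_operators t"
    using T by (intro adjoint_bounded_operators) (simp add: surjective_isometries_def)
  ultimately show ?thesis by (simp add: surjective_isometries_def)
qed

end

lemma scalar_dual_pair_swap: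
  assumes "scalar_dual_pair p s t" "dual_pair (\<lambda>y x. p x y)"
  shows "scalar_dual_pair (\<lambda>y x. p x y) t s"
proof -
  interpret scalar_dual_pair p s t by fact
  show ?thesis
    by (intro scalar_dual_pair.intro scalar_dual_pair_axioms.intro assms(2) left_space right_space)
      (simp add: pairing_scale)
qed

text \<open>\<open>HG\<close> is conditional because adjoints of operators on \<open>'b\<close> act
  on \<open>'a\<close> only once the reversed pairing is a dual pair. That comes from smoothness of
  \<open>'a\<close>: obtained directly from \<open>G\<close>, or through convexity of
  \<open>'b\<close> from \<open>H\<close>.\<close>

lemma dual_pair_uniformly_micro_iff:
  fixes p :: "'a::banach \<Rightarrow> 'b::banach \<Rightarrow> real"
  assumes pair: "dual_pair p"
    and G: "\<forall>T\<in>G. norm T \<le> 1" and H: "\<forall>T\<in>H. norm T \<le> 1"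
    and GH: "\<And>T. T \<in> G \<Longrightarrow> dual_pair.adjoint p T \<in> H"
    and HG: "\<And>T. dual_pair (\<lambda>y x. p x y) \<Longrightarrow> T \<in> H \<Longrightarrow> dual_pair.adjoint (\<lambda>y x. p x y) T \<in> G"
  shows "uniformly_micro G \<longleftrightarrow> uniformly_micro H"
proof
  interpret dual_pair p by (rule pair)
  assume um: "uniformly_micro G"
  have smooth: "uniformly_smooth TYPE('a)" by (rule uniformly_micro_imp_uniformly_smooth[OF um G])
  then have swap: "dual_pair (\<lambda>y x. p x y)"
    by (intro dual_pair_swap uniformly_smooth_imp_reflexive)
  have convex: "uniformly_convex TYPE('a)" by (rule uniformly_micro_imp_uniformly_convex[OF um G])
  show "uniformly_micro H"
    by (rule uniformly_micro_adjoint[OF swap pairing_smooth_if_left_smooth[OF smooth]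
          dual_pair.pairing_smooth_if_right_convex[OF swap convex] um G GH])
next
  interpret dual_pair p by (rule pair)
  assume um: "uniformly_micro H"
  have pairing_smooth: "pairing_uniformly_smooth p"
    by (rule pairing_smooth_if_right_convex[OF uniformly_micro_imp_uniformly_convex[OF um H]])
  then have swap: "dual_pair (\<lambda>y x. p x y)"
    by (intro dual_pair_swap uniformly_smooth_imp_reflexive left_smooth_if_pairing_smooth)
  show "uniformly_micro G"
    by (rule dual_pair.uniformly_micro_adjoint[OF swap pair
          dual_pair.pairing_smooth_if_left_smooth[OF swap uniformly_micro_imp_uniformly_smooth[OF um H]]
          pairing_smooth um H HG[OF swap]])
qed

theorem scalar_dual_pair_micro_iff:
  fixes p :: "'a::banach \<Rightarrow> 'b::banach \<Rightarrow> real"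
    and s :: "'k::field \<Rightarrow> 'a \<Rightarrow> 'a" and t :: "'k \<Rightarrow> 'b \<Rightarrow> 'b"
  assumes pair: "scalar_dual_pair p s t"
  shows "uniformly_micro_semitransitive s \<longleftrightarrow> uniformly_micro_semitransitive t"
    and "micro_transitive s \<longleftrightarrow> micro_transitive t"
proof -
  interpret scalar_dual_pair p s t by (rule pair)
  note swapped = scalar_dual_pair_swap[OF pair]
  have contr: "\<forall>T\<in>contractions u. norm T \<le> 1" for u :: "'k \<Rightarrow> 'c::real_normed_vector \<Rightarrow> 'c"
    by (simp add: contractions_def)
  have isom: "\<forall>T\<in>surjective_isometries u. norm T \<le> 1" for u :: "'k \<Rightarrow> 'c::real_normed_vector \<Rightarrow> 'c"
    using surjective_isometries_norm_le by blast
  show "uniformly_micro_semitransitive s \<longleftrightarrow> uniformly_micro_semitransitive t"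
    unfolding uniformly_micro_semitransitive_iff
    by (rule dual_pair_uniformly_micro_iff[OF dual_pair_axioms contr contr adjoint_contractions])
      (auto intro: scalar_dual_pair.adjoint_contractions[OF swapped])
  show "micro_transitive s \<longleftrightarrow> micro_transitive t"
    unfolding micro_transitive_iff[OF left_space] micro_transitive_iff[OF right_space]
    by (rule dual_pair_uniformly_micro_iff[OF dual_pair_axioms isom isom adjoint_surjective_isometries])
      (auto intro: scalar_dual_pair.adjoint_surjective_isometries[OF swapped])
qed

section \<open>Real and complex duals\<close>

lemma real_dual_pair:
  "scalar_dual_pair (\<lambda>x f. blinfun_apply f x) scaleR (scaleR :: real \<Rightarrow> ('a::real_normed_vector \<Rightarrow>\<^sub>L real) \<Rightarrow> _)"
proof (intro scalar_dual_pair.intro dual_pair.intro scalar_dual_pair_axioms.intro dual_pair_axioms.intro)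
  show "bounded_bilinear (\<lambda>x f. blinfun_apply f (x :: 'a) :: real)"
    by (rule bounded_bilinear.flip[OF bounded_bilinear_blinfun_apply])
  show "blinfun_apply f x \<le> norm x * norm f" for f :: "'a \<Rightarrow>\<^sub>L real" and x
    using blinfun_le[OF order_refl order_refl, of f x] by (simp add: mult.commute)
  show "\<exists>f. \<forall>x. blinfun_apply F x = blinfun_apply f x" for F :: "'a \<Rightarrow>\<^sub>L real" by blast
  show "norm f \<le> c" if "c \<ge> 0" "\<And>x. norm x \<le> 1 \<Longrightarrow> blinfun_apply f x \<le> c" for f :: "'a \<Rightarrow>\<^sub>L real" and c
    using that by (rule blinfun_norm_le)
  show "vector_space (scaleR :: real \<Rightarrow> 'a \<Rightarrow> 'a)" by (rule real_vector.vector_space_axioms)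
  show "vector_space (scaleR :: real \<Rightarrow> ('a \<Rightarrow>\<^sub>L real) \<Rightarrow> _)" by (rule real_vector.vector_space_axioms)
  show "blinfun_apply f (c *\<^sub>R x) = blinfun_apply (c *\<^sub>R f) x" for f :: "'a \<Rightarrow>\<^sub>L real" and c x
    by (simp add: blinfun.scaleR_right blinfun.scaleR_left)
qed

lemma cdual_scaleC: "blinfun_of_cdual f (c *\<^sub>C x) = c * blinfun_of_cdual f x"
  using blinfun_of_cdual[of f] by (simp add: linear_scaleC_mult_iff)

text \<open>Complex linearity forces the imaginary part at \<open>x\<close> to be minus the real
  part at \<open>\<i> *\<^sub>C x\<close>, hence the formula for \<open>h\<close>.\<close>

lemma complexification:
  fixes F :: "'a::complex_normed_vector \<Rightarrow>\<^sub>L real"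
  obtains f :: "'a cdual" where "\<And>x. Re (blinfun_of_cdual f x) = F x"
proof -
  define h where "h x = complex_of_real (F x) - \<i> * complex_of_real (F (\<i> *\<^sub>C x))" for x
  have decompose: "c *\<^sub>C x = Re c *\<^sub>R x + Im c *\<^sub>R (\<i> *\<^sub>C x)" for c and x :: 'a
  proof -
    have "c *\<^sub>C x = (of_real (Re c) + of_real (Im c) * \<i>) *\<^sub>C x"
      by (metis complex_eq mult.commute)
    then show ?thesis
      by (simp add: scaleC_add_left scaleC_scaleC[symmetric] scaleC_of_real)
  qed
  have ii: "\<i> *\<^sub>C (\<i> *\<^sub>C x) = - x" for x :: 'a
    using scaleC_of_real[of "-1" x] by (simp add: scaleC_scaleC)
  have iR: "\<i> *\<^sub>C (r *\<^sub>R x) = r *\<^sub>R (\<i> *\<^sub>C x)" for r and x :: 'a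
    by (simp add: scaleC_of_real[symmetric] scaleC_scaleC mult.commute)
  have "bounded_linear h"
  proof (rule bounded_linear_intro[of _ "2 * norm F"])
    show "h (x + y) = h x + h y" for x y
      by (simp add: h_def scaleC_add_right blinfun.add_right algebra_simps)
    show "h (r *\<^sub>R x) = r *\<^sub>R h x" for r x
      by (simp add: h_def iR blinfun.scaleR_right scaleR_conv_of_real algebra_simps)
    show "norm (h x) \<le> norm x * (2 * norm F)" for x
    proof -
      have "norm (h x) \<le> \<bar>F x\<bar> + \<bar>F (\<i> *\<^sub>C x)\<bar>"
        unfolding h_def using norm_triangle_ineq4 by (rule order_trans) (simp add: norm_mult)
      also have "\<dots> \<le> norm F * norm x + norm F * norm x"
        using norm_blinfun[of F x] norm_blinfun[of F "\<i> *\<^sub>C x"] by (intro add_mono) (simp_all add: norm_scaleC)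
      finally show ?thesis by (simp add: algebra_simps)
    qed
  qed
  then have h: "blinfun_apply (Blinfun h) = h" by (rule bounded_linear_Blinfun_apply)
  have "h (c *\<^sub>C x) = c * h x" for c x
    by (simp add: h_def decompose[of c] scaleC_add_right iR ii blinfun.add_right blinfun.scaleR_right
        blinfun.minus_right blinfun.diff_right complex_eq_iff)
  then have "blinfun_of_cdual (Abs_cdual (Blinfun h)) = Blinfun h"
    by (intro Abs_cdual_inverse) (simp add: linear_scaleC_mult_iff h)
  then show ?thesis by (intro that[of "Abs_cdual (Blinfun h)"]) (simp add: h h_def)
qed

text \<open>The real part of a complex functional loses no norm: rotating \<open>x\<close> by a
  unimodular scalar makes the value real and nonnegative.\<close>

lemma complex_dual_pair:
  "scalar_dual_pair (\<lambda>x f. Re (blinfun_apply (blinfun_of_cdual f) x)) scaleC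
    (scaleC :: complex \<Rightarrow> 'a::complex_normed_vector cdual \<Rightarrow> _)"
proof (intro scalar_dual_pair.intro dual_pair.intro scalar_dual_pair_axioms.intro dual_pair_axioms.intro vector_space_scaleC)
  have bound: "\<bar>Re (blinfun_of_cdual f x)\<bar> \<le> norm x * norm f" for f and x :: 'a
    using order_trans[OF abs_Re_le_cmod norm_blinfun[of "blinfun_of_cdual f" x]]
    by (simp add: norm_cdual.rep_eq mult.commute)
  show "bounded_bilinear (\<lambda>x f. Re (blinfun_of_cdual f (x :: 'a)))"
    by (rule bounded_bilinear.intro)
      (use bound in \<open>auto simp: plus_cdual.rep_eq scaleR_cdual.rep_eq blinfun.add_left blinfun.add_right
        blinfun.scaleR_left blinfun.scaleR_right intro!: exI[of _ 1]\<close>)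
  show "Re (blinfun_of_cdual f x) \<le> norm x * norm f" for f and x :: 'a
    using bound[of f x] by simp
  show "\<exists>f. \<forall>x. blinfun_apply F x = Re (blinfun_of_cdual f x)" for F :: "'a \<Rightarrow>\<^sub>L real"
    by (rule complexification[of F]) metis
  show "norm f \<le> c" if "c \<ge> 0" and le: "\<And>x. norm x \<le> 1 \<Longrightarrow> Re (blinfun_of_cdual f x) \<le> c" for f :: "'a cdual" and c
    unfolding norm_cdual.rep_eq
  proof (rule norm_blinfun_bound[OF \<open>c \<ge> 0\<close>])
    fix x :: 'a
    show "norm (blinfun_of_cdual f x) \<le> c * norm x"
    proof (cases "x = 0 \<or> blinfun_of_cdual f x = 0")
      case True then show ?thesis using \<open>c \<ge> 0\<close> by (auto simp: blinfun.zero_right)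
    next
      case False
      define w where "w = blinfun_of_cdual f x"
      \<comment> \<open>\<open>u\<close> rotates the value \<open>w\<close> to \<open>norm w\<close>
        and at the same time scales \<open>x\<close> to norm 1.\<close>
      define u where "u = cnj (sgn w) / of_real (norm x)"
      have "norm (u *\<^sub>C x) \<le> 1"
        using False by (simp add: u_def norm_scaleC norm_divide norm_sgn)
      then have "Re (blinfun_of_cdual f (u *\<^sub>C x)) \<le> c" by (rule le)
      moreover have "u * w = of_real (norm w / norm x)"
      proof -
        have "cnj (sgn w) * w = of_real (norm w)"
          using False complex_norm_square[of w]
          by (simp add: w_def sgn_eq power2_eq_square nonzero_divide_eq_eq mult.commute)
        then show ?thesis by (simp add: u_def)
      qed
      ultimately have "norm w / norm x \<le> c" by (simp add: cdual_scaleC w_def[symmetric])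
      then show ?thesis using False by (simp add: w_def field_simps)
    qed
  qed
  show "Re (blinfun_of_cdual f (c *\<^sub>C x)) = Re (blinfun_of_cdual (c *\<^sub>C f) x)" for f and c and x :: 'a
    by (simp add: cdual_scaleC scaleC_cdual.rep_eq bounded_linear_Blinfun_apply bounded_linear_mult_right)
qed

theorem proposition3p4:
  shows "((uniformly_micro_semitransitive (scaleR :: real \<Rightarrow> 'a::banach \<Rightarrow> 'a) \<longleftrightarrow>
            uniformly_micro_semitransitive (scaleR :: real \<Rightarrow> ('a \<Rightarrow>\<^sub>L real) \<Rightarrow> ('a \<Rightarrow>\<^sub>L real))) \<and>
          (micro_transitive (scaleR :: real \<Rightarrow> 'a \<Rightarrow> 'a) \<longleftrightarrow>
            micro_transitive (scaleR :: real \<Rightarrow> ('a \<Rightarrow>\<^sub>L real) \<Rightarrow> ('a \<Rightarrow>\<^sub>L real)))) \<and>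
         ((uniformly_micro_semitransitive (scaleC :: complex \<Rightarrow> 'b::complex_banach \<Rightarrow> 'b) \<longleftrightarrow>
            uniformly_micro_semitransitive (scaleC :: complex \<Rightarrow> 'b cdual \<Rightarrow> 'b cdual)) \<and>
          (micro_transitive (scaleC :: complex \<Rightarrow> 'b \<Rightarrow> 'b) \<longleftrightarrow>
            micro_transitive (scaleC :: complex \<Rightarrow> 'b cdual \<Rightarrow> 'b cdual)))"
  by (intro conjI scalar_dual_pair_micro_iff[OF real_dual_pair] scalar_dual_pair_micro_iff[OF complex_dual_pair])

end
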